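(* The following problem is undecidable, both for finite words and for infinite words: given integral NMDAs $\mathcal{A}$ and $\mathcal{B}$ over the same alphabet, decide whether $\mathcal{A}(w)=\mathcal{B}(w)$ for all words $w$.
   Context: An alphabet $\Sigma$ is a finite nonempty set; "finite words" range over $\Sigma^+$ and infinite words over $\Sigma^\omega$. An NMDA is a tuple $\mathcal{A}=\langle \Sigma,Q,\iota,\delta,\gamma,\rho\rangle$ with finite state set $Q$, initial states $\iota\subseteq Q$, transition relation $\delta\subseteq Q\times\Sigma\times Q$, weight function $\gamma:\delta\to\mathbb{Q}$ and discount-factor function $\rho:\delta\to\mathbb{Q}\cap(1,\infty)$; NMDAs are assumed complete (every state has at least one outgoing transition on every letter). A run on a finite or infinite word $w=\sigma_0\sigma_1\cdots$ is $p_0,\sigma_0,p_1,\ldots$ with $p_0\in\iota$ and $t_i=(p_i,\sigma_i,p_{i+1})\in\delta$; its value is $\sum_{i}\gamma(t_i)\prod_{j<i}\frac{1}{\rho(t_j)}$, and $\mathcal{A}(w)$ is the infimum of values of runs on $w$. An NMDA is integral if all discount factors are integers. *)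

theory Defs
  imports Complex_Main "HOL-Library.Extended_Real" "HOL-Library.Nat_Bijection"
begin

section \<open>Nondeterministic discounted-sum automata with multiple discount factors\<close>

text \<open>The functions \<open>weight\<close> and \<open>discount\<close> are total, but only their values on
  \<open>transitions\<close> are ever used.\<close>

record ('a, 'q) nmda =
  alphabet :: "'a set"
  states :: "'q set"
  initial :: "'q set"
  transitions :: "('q \<times> 'a \<times> 'q) set"
  weight :: "'q \<times> 'a \<times> 'q \<Rightarrow> rat"
  discount :: "'q \<times> 'a \<times> 'q \<Rightarrow> rat"

definition is_nmda :: "('a, 'q) nmda \<Rightarrow> bool" where
  "is_nmda A \<longleftrightarrow>
     finite (alphabet A) \<and> alphabet A \<noteq> {} \<and>
     finite (states A) \<and>
     initial A \<subseteq> states A \<and>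
     transitions A \<subseteq> states A \<times> alphabet A \<times> states A \<and>
     (\<forall>t\<in>transitions A. discount A t > 1) \<and>
     (\<forall>p\<in>states A. \<forall>a\<in>alphabet A. \<exists>q. (p, a, q) \<in> transitions A)"

definition integral_nmda :: "('a, 'q) nmda \<Rightarrow> bool" where
  "integral_nmda A \<longleftrightarrow> (\<forall>t\<in>transitions A. discount A t \<in> \<int>)"

definition finite_words :: "'a set \<Rightarrow> 'a list set" where
  "finite_words S = {w. w \<noteq> [] \<and> set w \<subseteq> S}"

definition infinite_words :: "'a set \<Rightarrow> (nat \<Rightarrow> 'a) set" where
  "infinite_words S = {w. \<forall>i. w i \<in> S}"

definition trans_at :: "(nat \<Rightarrow> 'q) \<Rightarrow> (nat \<Rightarrow> 'a) \<Rightarrow> nat \<Rightarrow> 'q \<times> 'a \<times> 'q" where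
  "trans_at p w i = (p i, w i, p (Suc i))"

definition discounted_weight :: "('a, 'q) nmda \<Rightarrow> (nat \<Rightarrow> 'q \<times> 'a \<times> 'q) \<Rightarrow> nat \<Rightarrow> real" where
  "discounted_weight A t i =
     real_of_rat (weight A (t i)) * (\<Prod>j<i. 1 / real_of_rat (discount A (t j)))"

definition finite_runs :: "('a, 'q) nmda \<Rightarrow> 'a list \<Rightarrow> 'q list set" where
  "finite_runs A w =
     {p. length p = Suc (length w) \<and> p ! 0 \<in> initial A \<and>
         (\<forall>i<length w. trans_at ((!) p) ((!) w) i \<in> transitions A)}"

definition infinite_runs :: "('a, 'q) nmda \<Rightarrow> (nat \<Rightarrow> 'a) \<Rightarrow> (nat \<Rightarrow> 'q) set" where
  "infinite_runs A w =
     {p. p 0 \<in> initial A \<and> (\<forall>i. trans_at p w i \<in> transitions A)}"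

definition finite_run_value :: "('a, 'q) nmda \<Rightarrow> 'a list \<Rightarrow> 'q list \<Rightarrow> real" where
  "finite_run_value A w p =
     (\<Sum>i<length w. discounted_weight A (trans_at ((!) p) ((!) w)) i)"

definition infinite_run_value :: "('a, 'q) nmda \<Rightarrow> (nat \<Rightarrow> 'a) \<Rightarrow> (nat \<Rightarrow> 'q) \<Rightarrow> real" where
  "infinite_run_value A w p = (\<Sum>i. discounted_weight A (trans_at p w) i)"

text \<open>The infimum is taken in the extended reals: \<open>initial\<close> may be empty, and then there is no run
  and every word has value \<open>\<infinity>\<close>.\<close>

definition finite_word_value :: "('a, 'q) nmda \<Rightarrow> 'a list \<Rightarrow> ereal" where
  "finite_word_value A w = (INF p\<in>finite_runs A w. ereal (finite_run_value A w p))"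

definition infinite_word_value :: "('a, 'q) nmda \<Rightarrow> (nat \<Rightarrow> 'a) \<Rightarrow> ereal" where
  "infinite_word_value A w = (INF p\<in>infinite_runs A w. ereal (infinite_run_value A w p))"


section \<open>Partial recursive functions and decision problems\<close>

datatype recf =
    Zero
  | Succ
  | Proj nat
  | Comp recf "recf list"
  | PrimRec recf recf
  | Mu recf

text \<open>\<open>rec_eval f xs y\<close>: the partial recursive function denoted by \<open>f\<close> is defined on the
  arguments \<open>xs\<close> and has value \<open>y\<close> there. Recursion and minimisation run over the first argument.\<close>

inductive rec_eval :: "recf \<Rightarrow> nat list \<Rightarrow> nat \<Rightarrow> bool" where
  zero: "rec_eval Zero xs 0"
| succ: "rec_eval Succ [x] (Suc x)"
| proj: "i < length xs \<Longrightarrow> rec_eval (Proj i) xs (xs ! i)"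
| comp: "list_all2 (\<lambda>g y. rec_eval g xs y) gs ys \<Longrightarrow> rec_eval f ys z \<Longrightarrow>
    rec_eval (Comp f gs) xs z"
| prim_0: "rec_eval f xs y \<Longrightarrow> rec_eval (PrimRec f g) (0 # xs) y"
| prim_Suc: "rec_eval (PrimRec f g) (n # xs) r \<Longrightarrow> rec_eval g (n # r # xs) y \<Longrightarrow>
    rec_eval (PrimRec f g) (Suc n # xs) y"
| mu: "rec_eval f (n # xs) 0 \<Longrightarrow> (\<forall>m<n. \<exists>k. rec_eval f (m # xs) (Suc k)) \<Longrightarrow>
    rec_eval (Mu f) xs n"

inductive_cases rec_eval_cases:
  "rec_eval Zero xs y" "rec_eval Succ xs y" "rec_eval (Proj i) xs y" "rec_eval (Comp f gs) xs y"
  "rec_eval (PrimRec f g) (0 # xs) y" "rec_eval (PrimRec f g) (Suc n # xs) y" "rec_eval (Mu f) xs y"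

lemma rec_eval_deterministic:
  assumes "rec_eval f xs y" and "rec_eval f xs z"
  shows "y = z"
  using assms
proof (induction f xs y arbitrary: z rule: rec_eval.induct)
  case (comp xs gs ys f y)
  from comp.prems obtain ys' where
    *: "list_all2 (\<lambda>g y. rec_eval g xs y) gs ys'" "rec_eval f ys' z"
    by (rule rec_eval_cases(4))
  have "ys = ys'"
  proof (rule nth_equalityI)
    show "length ys = length ys'"
      using list_all2_lengthD[OF comp.IH(1)] list_all2_lengthD[OF *(1)] by simp
    show "ys ! i = ys' ! i" if "i < length ys" for i
      using list_all2_nthD2[OF comp.IH(1) that] list_all2_nthD[OF *(1), of i] that
        list_all2_lengthD[OF comp.IH(1)] list_all2_lengthD[OF *(1)] by simp
  qed
  with comp.IH(2)[of z] *(2) show ?case by simp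
next
  case (mu f n xs)
  from mu.prems have z: "rec_eval f (z # xs) 0" "\<forall>m<z. \<exists>k. rec_eval f (m # xs) (Suc k)"
    by (auto elim!: rec_eval_cases(7))
  show ?case
  proof (cases n z rule: linorder_cases)
    case less
    with z(2) obtain k where "rec_eval f (n # xs) (Suc k)" by blast
    from mu.IH(1)[OF this] show ?thesis by simp
  next
    case greater
    with mu.IH(2) obtain k where "\<forall>y. rec_eval f (z # xs) y \<longrightarrow> Suc k = y" by blast
    with z(1) have "Suc k = 0" by blast
    then show ?thesis by simp
  qed simp
next
  case (prim_0 f xs y g)
  from prim_0.prems show ?case by (rule rec_eval_cases(5)) (rule prim_0.IH)
next
  case (prim_Suc f g n xs r y)
  from prim_Suc.prems obtain r' where
    *: "rec_eval (PrimRec f g) (n # xs) r'" "rec_eval g (n # r' # xs) z"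
    by (rule rec_eval_cases(6))
  from prim_Suc.IH(1)[OF *(1)] *(2) show ?case by (simp add: prim_Suc.IH(2))
qed (auto elim: rec_eval_cases(1-3))

text \<open>A decision problem consists of a set \<open>I\<close> of instances, an effective coding of instances by
  natural numbers, and the property \<open>P\<close> of instances to be decided. The algorithm may behave
  arbitrarily, including diverge, on numbers that do not code an instance.\<close>

definition decidable_problem :: "'i set \<Rightarrow> ('i \<Rightarrow> nat) \<Rightarrow> ('i \<Rightarrow> bool) \<Rightarrow> bool" where
  "decidable_problem I code P \<longleftrightarrow>
     (\<exists>f. \<forall>x\<in>I. rec_eval f [code x] (if P x then 1 else 0))"


section \<open>Coding of automata\<close>

text \<open>As instances we take automata whose letters and states are natural numbers, which up to
  renaming are all of them. Numerators, denominators, transitions and finite sets are coded with the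
  explicit bijections of \<open>Nat_Bijection\<close>.\<close>

definition rat_code :: "rat \<Rightarrow> nat" where
  "rat_code r = (case quotient_of r of (n, d) \<Rightarrow> prod_encode (int_encode n, int_encode d))"

definition trans_code :: "nat \<times> nat \<times> nat \<Rightarrow> nat" where
  "trans_code t = (case t of (p, a, q) \<Rightarrow> prod_encode (p, prod_encode (a, q)))"

definition nmda_code :: "(nat, nat) nmda \<Rightarrow> nat" where
  "nmda_code A = list_encode
     [set_encode (alphabet A), set_encode (states A), set_encode (initial A),
      set_encode ((\<lambda>t. list_encode [trans_code t, rat_code (weight A t), rat_code (discount A t)])
        ` transitions A)]"

lemma inj_rat_code: "inj rat_code"
  by (rule injI)
    (auto simp: rat_code_def int_encode_eq split: prod.splits intro: quotient_of_inject)

lemma inj_trans_code: "inj trans_code"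
  by (rule injI) (auto simp: trans_code_def split: prod.splits)

lemma nmda_code_faithful:
  assumes "is_nmda A" "is_nmda B" "nmda_code A = nmda_code B"
  shows "alphabet A = alphabet B" "states A = states B" "initial A = initial B"
    "transitions A = transitions B"
    "\<forall>t\<in>transitions A. weight A t = weight B t \<and> discount A t = discount B t"
proof -
  let ?g = "\<lambda>A t. list_encode [trans_code t, rat_code (weight A t), rat_code (discount A t)]"
  have fin: "finite (alphabet C)" "finite (states C)" "finite (initial C)"
      "finite (transitions C)" if "is_nmda C" for C :: "(nat, nat) nmda"
  proof -
    from that have *: "finite (alphabet C)" "finite (states C)" "initial C \<subseteq> states C"
      "transitions C \<subseteq> states C \<times> alphabet C \<times> states C"
      unfolding is_nmda_def by blast+
    then show "finite (alphabet C)" "finite (states C)" "finite (initial C)"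
      by (blast intro: finite_subset)+
    show "finite (transitions C)"
      by (rule finite_subset[OF *(4)]) (intro finite_cartesian_product *)
  qed
  note fin = fin[OF assms(1)] fin[OF assms(2)]
  have "[set_encode (alphabet A), set_encode (states A), set_encode (initial A),
         set_encode (?g A ` transitions A)] =
        [set_encode (alphabet B), set_encode (states B), set_encode (initial B),
         set_encode (?g B ` transitions B)]"
    using assms(3) unfolding nmda_code_def by (simp only: list_encode_eq)
  then have eqs: "set_encode (alphabet A) = set_encode (alphabet B)"
      "set_encode (states A) = set_encode (states B)"
      "set_encode (initial A) = set_encode (initial B)"
      "set_encode (?g A ` transitions A) = set_encode (?g B ` transitions B)"
    by simp_all
  from eqs(1-3) fin show "alphabet A = alphabet B" "states A = states B" "initial A = initial B"
    by (simp_all add: set_encode_eq)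
  have im: "?g A ` transitions A = ?g B ` transitions B"
    using eqs(4) fin by (simp only: set_encode_eq finite_imageI)
  have g: "t = u \<and> weight C t = weight D u \<and> discount C t = discount D u"
    if "?g C t = ?g D u" for C D :: "(nat, nat) nmda" and t u
    using that
    unfolding list_encode_eq list.inject inj_eq[OF inj_trans_code] inj_eq[OF inj_rat_code] by blast
  have sub: "t \<in> transitions D \<and> weight C t = weight D t \<and> discount C t = discount D t"
    if "?g C ` transitions C = ?g D ` transitions D" "t \<in> transitions C"
    for C D :: "(nat, nat) nmda" and t
  proof -
    have "?g C t \<in> ?g D ` transitions D" unfolding that(1)[symmetric] by (rule imageI) (rule that(2))
    then obtain u where u: "?g C t = ?g D u" "u \<in> transitions D" by (rule imageE)
    show ?thesis using g[OF u(1)] u(2) by metis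
  qed
  show "transitions A = transitions B"
    "\<forall>t\<in>transitions A. weight A t = weight B t \<and> discount A t = discount B t"
    using sub[OF im] sub[OF im[symmetric]] by fast+
qed

definition integral_nmda_pairs :: "((nat, nat) nmda \<times> (nat, nat) nmda) set" where
  "integral_nmda_pairs =
     {(A, B). is_nmda A \<and> is_nmda B \<and> integral_nmda A \<and> integral_nmda B \<and>
              alphabet A = alphabet B}"

definition nmda_pair_code :: "(nat, nat) nmda \<times> (nat, nat) nmda \<Rightarrow> nat" where
  "nmda_pair_code = (\<lambda>(A, B). prod_encode (nmda_code A, nmda_code B))"

end

theory Submission
  imports Defs "HOL-Library.Countable"
begin

text \<open>A computation of a nondeterministic register program is written as a word of operations followed
  by an end letter. A reference run divides by 4 at every operation and collects \<open>-2\<close> at the end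
  letter, so it has value \<open>-2 / 4\<^sup>n\<close>. All other runs try to refute the computation: one checks that
  the operations form a word of the (regular) program, and the others follow a pair of registers with
  discount factors 2, 4, 8, so that at a guard \<open>4\<^sup>n\<close> divided by their discount product is 2 to the
  difference of the two contents. They get down to the reference value iff the word is not an
  accepting computation. Hence adding the reference run as a further initial state changes the
  automaton's function iff the program has an accepting computation.

  The input \<open>x\<close> of the program occurs in two weights only. Therefore a program can compute the code of
  its own pair of automata from an input listing the remaining parts of that code, run a supposed
  decision procedure on it and accept iff the answer is that the automata are equivalent. No
  universal machine is needed for this diagonal argument.\<close>

section \<open>Regular languages\<close>

text \<open>Register contents are integers, and this is what separates the values. A failing guard
  misses its bound by at least 1, so the run that challenges it gains a factor 2 and reaches
  \<open>-2 / 4 ^ n\<close>, while a challenge of a guard that holds cannot get below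
  \<open>-1 / 4 ^ n\<close>. The base is 4 because an increment may halve the factor of a step, and
  a base of 2 would then give the forbidden factor 1. Self-reference is the other difficulty: a
  program that contained the code of its own automata would be circular. As \<open>x\<close> occurs
  in no state, letter, transition or discount factor, but only as \<open>2 ^ x\<close> and
  \<open>1 / 2 ^ x\<close> in two weights, the program and the rest of the code are fixed before
  \<open>x\<close> is chosen, and \<open>x\<close> may then be set to a number that encodes this
  rest. Nondeterminism spares the decoding: the program guesses the parameters and encodes them for
  comparison with \<open>x\<close>, so no inverse of a pairing function has to be computed.\<close>

definition residual :: "'a list set \<Rightarrow> 'a list \<Rightarrow> 'a list set" where
  "residual L u = {v. u @ v \<in> L}"

text \<open>Finiteness of the set of residuals is the Myhill-Nerode form of regularity. It turns the
  closure properties into counting arguments without any automata to combine; one automaton is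
  extracted at the end, in \<open>regular_dfa\<close>.\<close>

definition regular :: "'a list set \<Rightarrow> bool" where
  "regular L \<longleftrightarrow> finite (range (residual L))"

definition conc :: "'a list set \<Rightarrow> 'a list set \<Rightarrow> 'a list set" where
  "conc K L = {u @ v |u v. u \<in> K \<and> v \<in> L}"

inductive_set star :: "'a list set \<Rightarrow> 'a list set" for L where
  Nil: "[] \<in> star L"
| app: "u \<in> L \<Longrightarrow> v \<in> star L \<Longrightarrow> u @ v \<in> star L"

lemma regular_empty: "regular {}"
  by (simp add: regular_def residual_def)

lemma regular_singleton: "regular {w}"
proof -
  have "range (residual {w}) \<subseteq> insert {} ((\<lambda>n. {drop n w}) ` {..length w})"
  proof
    fix K assume "K \<in> range (residual {w})"
    then obtain u where K: "K = {v. u @ v = w}" by (auto simp: residual_def)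
    show "K \<in> insert {} ((\<lambda>n. {drop n w}) ` {..length w})"
    proof (cases "\<exists>v. u @ v = w")
      case True
      then have "K = {drop (length u) w}" "length u \<le> length w" unfolding K by auto
      then show ?thesis by blast
    next
      case False
      then show ?thesis unfolding K by simp
    qed
  qed
  then show ?thesis unfolding regular_def by (rule finite_subset) simp
qed

text \<open>A word that completes \<open>u\<close> either completes a prefix in \<open>K\<close>
  still being read and goes on with \<open>L\<close>, or continues a part of \<open>L\<close> that
  began inside \<open>u\<close>. The residual is thus determined by one residual of \<open>K\<close>
  and a set of residuals of \<open>L\<close>.\<close>

lemma regular_conc:
  assumes "regular K" "regular L"
  shows "regular (conc K L)"
proof -
  let ?F = "\<lambda>(R, S). conc R L \<union> \<Union>S"
  have "range (residual (conc K L)) \<subseteq> ?F ` (range (residual K) \<times> Pow (range (residual L)))"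
  proof
    fix R assume "R \<in> range (residual (conc K L))"
    then obtain u where R: "R = residual (conc K L) u" by blast
    let ?S = "{residual L u2 |u1 u2. u1 @ u2 = u \<and> u1 \<in> K}"
    have "R = ?F (residual K u, ?S)"
    proof (intro equalityI subsetI)
      fix v assume "v \<in> R"
      then obtain k l where kl: "u @ v = k @ l" "k \<in> K" "l \<in> L" by (auto simp: R residual_def conc_def)
      then consider us where "k = u @ us" "v = us @ l" | us where "u = k @ us" "l = us @ v"
        by (metis append_eq_append_conv2)
      then show "v \<in> ?F (residual K u, ?S)"
      proof cases
        case 1
        then have "v \<in> conc (residual K u) L" using kl by (auto simp: residual_def conc_def)
        then show ?thesis by simp
      next
        case 2
        then have "v \<in> residual L us" "residual L us \<in> ?S" using kl by (auto simp: residual_def)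
        then show ?thesis by blast
      qed
    next
      fix v assume "v \<in> ?F (residual K u, ?S)"
      then consider k l where "u @ k \<in> K" "l \<in> L" "v = k @ l"
        | u1 u2 where "u1 @ u2 = u" "u1 \<in> K" "u2 @ v \<in> L"
        by (auto simp: residual_def conc_def)
      then show "v \<in> R"
      proof cases
        case 1
        then have "u @ v = (u @ k) @ l" by simp
        with 1 show ?thesis unfolding R residual_def conc_def by blast
      next
        case 2
        then have "u @ v = u1 @ (u2 @ v)" by auto
        with 2 show ?thesis unfolding R residual_def conc_def by blast
      qed
    qed
    then show "R \<in> ?F ` (range (residual K) \<times> Pow (range (residual L)))" by blast
  qed
  moreover have "finite (?F ` (range (residual K) \<times> Pow (range (residual L))))"
    using assms by (simp add: regular_def)
  ultimately show ?thesis unfolding regular_def by (rule finite_subset)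
qed

lemma star_append: "u \<in> star L \<Longrightarrow> v \<in> star L \<Longrightarrow> u @ v \<in> star L"
  by (induction rule: star.induct) (auto intro: star.intros)

text \<open>The cut falls at the end of the whole word or within a factor \<open>u2 @ v1\<close>; a
  cut between two factors is covered by \<open>u2 = []\<close>.\<close>

lemma star_append_cases:
  assumes "u @ v \<in> star L"
  shows "u \<in> star L \<and> v = [] \<or>
    (\<exists>u1 u2 v1 v2. u = u1 @ u2 \<and> v = v1 @ v2 \<and> u1 \<in> star L \<and> u2 @ v1 \<in> L \<and> v2 \<in> star L)"
  using assms
proof (induction "u @ v" arbitrary: u v rule: star.induct)
  case Nil
  then show ?case by (auto intro: star.intros)
next
  case (app a w)
  from app.hyps(4)[symmetric] consider
    (short) us where "u @ us = a" "us @ w = v" | (long) us where "u = a @ us" "us @ v = w"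
    by (metis append_eq_append_conv2)
  then show ?case
  proof cases
    case short
    then show ?thesis using app.hyps star.Nil by (metis append.left_neutral)
  next
    case long
    show ?thesis using app.hyps(3)[OF long(2)[symmetric]]
    proof (elim disjE exE conjE)
      assume "us \<in> star L" "v = []"
      then show ?thesis using long app.hyps(1) by (auto intro: star.app)
    next
      fix u1 u2 v1 v2
      assume *: "us = u1 @ u2" "v = v1 @ v2" "u1 \<in> star L" "u2 @ v1 \<in> L" "v2 \<in> star L"
      have "a @ u1 \<in> star L" using app.hyps(1) *(3) by (rule star.app)
      then show ?thesis using * long by (metis append.assoc)
    qed
  qed
qed

text \<open>What remains after \<open>u\<close> is the rest of a factor followed by
  \<open>star L\<close>, or nothing when \<open>u\<close> itself is in \<open>star L\<close>. A set
  of residuals of \<open>L\<close> and one bit determine this.\<close>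

lemma regular_star:
  assumes "regular L"
  shows "regular (star L)"
proof -
  let ?F = "\<lambda>(S, b). (\<Union>K\<in>S. conc K (star L)) \<union> (if b then {[]} else {})"
  have "range (residual (star L)) \<subseteq> ?F ` (Pow (range (residual L)) \<times> UNIV)"
  proof
    fix R assume "R \<in> range (residual (star L))"
    then obtain u where R: "R = residual (star L) u" by blast
    let ?S = "{residual L u2 |u1 u2. u1 @ u2 = u \<and> u1 \<in> star L}"
    have "R = ?F (?S, u \<in> star L)"
    proof (intro equalityI subsetI)
      fix v assume "v \<in> R"
      then have "u @ v \<in> star L" by (simp add: R residual_def)
      from star_append_cases[OF this] show "v \<in> ?F (?S, u \<in> star L)"
        by (auto simp: residual_def conc_def)
    next
      fix v assume "v \<in> ?F (?S, u \<in> star L)"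
      then consider "u \<in> star L" "v = []"
        | u1 u2 v1 v2 where "u1 @ u2 = u" "u1 \<in> star L" "u2 @ v1 \<in> L" "v2 \<in> star L" "v = v1 @ v2"
        by (auto simp: residual_def conc_def split: if_splits)
      then show "v \<in> R"
      proof cases
        case 2
        have "u1 @ (u2 @ v1) @ v2 \<in> star L" using 2 by (blast intro: star_append star.app)
        then show ?thesis using 2 by (auto simp: R residual_def)
      qed (simp add: R residual_def)
    qed
    then show "R \<in> ?F ` (Pow (range (residual L)) \<times> UNIV)" by blast
  qed
  moreover have "finite (?F ` (Pow (range (residual L)) \<times> UNIV))"
    using assms by (simp add: regular_def)
  ultimately show ?thesis unfolding regular_def by (rule finite_subset)
qed

text \<open>States are numbers assigned to the residuals, and a state accepts iff its residual
  contains the empty word.\<close>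

lemma regular_dfa:
  assumes "regular L"
  obtains \<delta> :: "nat \<Rightarrow> 'a \<Rightarrow> nat" and q0 F M
  where "q0 < M" "\<And>q a. q < M \<Longrightarrow> \<delta> q a < M" "\<And>w. w \<in> L \<longleftrightarrow> foldl \<delta> q0 w \<in> F"
proof -
  let ?R = "range (residual L)"
  obtain n and f :: "'a list set \<Rightarrow> nat" where f: "f ` ?R = {i. i < n}" "inj_on f ?R"
    using finite_imp_inj_to_nat_seg[OF assms[unfolded regular_def]] by metis
  let ?g = "inv_into ?R f"
  define \<delta> where "\<delta> q a = f {v. a # v \<in> ?g q}" for q a
  have g: "?g (f (residual L u)) = residual L u" for u
    using f(2) by (simp add: inv_into_f_f)
  have step: "\<delta> (f (residual L u)) a = f (residual L (u @ [a]))" for u a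
    unfolding \<delta>_def g by (simp add: residual_def)
  have run: "foldl \<delta> (f (residual L u)) w = f (residual L (u @ w))" for u w
    by (induction w arbitrary: u) (auto simp: step)
  have sub: "f (residual L u) < n" for u using f(1) by blast
  show thesis
  proof (rule that[of "f (residual L [])" n \<delta> "{q. [] \<in> ?g q}"])
    show "f (residual L []) < n" by (rule sub)
    show "\<delta> q a < n" if "q < n" for q a
    proof -
      from that have "q \<in> f ` ?R" using f(1) by simp
      then obtain u where "q = f (residual L u)" by blast
      then show ?thesis using step sub by simp
    qed
    show "w \<in> L \<longleftrightarrow> foldl \<delta> (f (residual L [])) w \<in> {q. [] \<in> ?g q}" for w
      unfolding run mem_Collect_eq g by (simp add: residual_def)
  qed
qed


section \<open>Register programs\<close>

text \<open>Programs are nondeterministic: a program is a language of straight-line operation sequences,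
  and a computation is a word of the language all of whose guards hold.
  The instance parameter \<open>x\<close> is visible only to the guards \<open>InLe\<close> and \<open>InGe\<close>.
  Register 1 is never written and supplies the constant 0.\<close>

datatype op = Copy nat nat | Inc nat | Leq nat nat | InLe | InGe

instance op :: countable by countable_datatype

fun guard :: "nat \<Rightarrow> op \<Rightarrow> (nat \<Rightarrow> nat) \<Rightarrow> bool" where
  "guard x (Leq k l) \<sigma> \<longleftrightarrow> \<sigma> k \<le> \<sigma> l"
| "guard x InLe \<sigma> \<longleftrightarrow> \<sigma> 0 \<le> \<sigma> 1 + x"
| "guard x InGe \<sigma> \<longleftrightarrow> \<sigma> 1 + x \<le> \<sigma> 0"
| "guard x _ \<sigma> \<longleftrightarrow> True"

fun upd :: "op \<Rightarrow> (nat \<Rightarrow> nat) \<Rightarrow> nat \<Rightarrow> nat" where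
  "upd (Copy k l) \<sigma> = \<sigma>(k := \<sigma> l)"
| "upd (Inc k) \<sigma> = \<sigma>(k := Suc (\<sigma> k))"
| "upd _ \<sigma> = \<sigma>"

fun regs :: "op \<Rightarrow> nat set" where
  "regs (Copy k l) = {k, l}"
| "regs (Inc k) = {k}"
| "regs (Leq k l) = {k, l}"
| "regs InLe = {0, 1}"
| "regs InGe = {0, 1}"

fun valid :: "nat \<Rightarrow> op list \<Rightarrow> (nat \<Rightarrow> nat) \<Rightarrow> bool" where
  "valid x [] \<sigma> \<longleftrightarrow> True"
| "valid x (a # w) \<sigma> \<longleftrightarrow> guard x a \<sigma> \<and> valid x w (upd a \<sigma>)"

lemma valid_append: "valid x (u @ v) \<sigma> \<longleftrightarrow> valid x u \<sigma> \<and> valid x v (fold upd u \<sigma>)"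
  by (induction u arbitrary: \<sigma>) auto

definition run :: "nat \<Rightarrow> op list set \<Rightarrow> (nat \<Rightarrow> nat) \<Rightarrow> (nat \<Rightarrow> nat) \<Rightarrow> bool" where
  "run x L \<sigma> \<tau> \<longleftrightarrow> (\<exists>w\<in>L. valid x w \<sigma> \<and> \<tau> = fold upd w \<sigma>)"

text \<open>The type \<open>op\<close> is infinite; the common register bound is what makes the
  alphabet of the automata finite.\<close>

definition prog :: "op list set \<Rightarrow> bool" where
  "prog L \<longleftrightarrow> regular L \<and> (\<exists>N. \<forall>w\<in>L. \<forall>a\<in>set w. regs a \<subseteq> {..<N})"

lemma run_empty [simp]: "run x {} \<sigma> \<tau> \<longleftrightarrow> False"
  by (simp add: run_def)

lemma run_singleton [simp]: "run x {[a]} \<sigma> \<tau> \<longleftrightarrow> guard x a \<sigma> \<and> \<tau> = upd a \<sigma>"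
  by (simp add: run_def)

lemma run_conc [simp]: "run x (conc K L) \<sigma> \<tau> \<longleftrightarrow> (\<exists>\<rho>. run x K \<sigma> \<rho> \<and> run x L \<rho> \<tau>)"
proof
  assume "run x (conc K L) \<sigma> \<tau>"
  then obtain u v where "u \<in> K" "v \<in> L" "valid x (u @ v) \<sigma>" "\<tau> = fold upd (u @ v) \<sigma>"
    by (auto simp: run_def conc_def)
  then show "\<exists>\<rho>. run x K \<sigma> \<rho> \<and> run x L \<rho> \<tau>"
    unfolding run_def by (auto simp: valid_append)
next
  assume "\<exists>\<rho>. run x K \<sigma> \<rho> \<and> run x L \<rho> \<tau>"
  then obtain u v where "u \<in> K" "valid x u \<sigma>" "v \<in> L" "valid x v (fold upd u \<sigma>)"
    "\<tau> = fold upd v (fold upd u \<sigma>)" unfolding run_def by blast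
  then show "run x (conc K L) \<sigma> \<tau>"
    unfolding run_def conc_def by (intro bexI[of _ "u @ v"]) (auto simp: valid_append)
qed

lemma run_star [simp]: "run x (star L) = (run x L)\<^sup>*\<^sup>*"
proof (intro ext iffI)
  fix \<sigma> \<tau>
  assume "run x (star L) \<sigma> \<tau>"
  then obtain w where w: "w \<in> star L" "valid x w \<sigma>" "\<tau> = fold upd w \<sigma>" by (auto simp: run_def)
  from w(1,2) have "(run x L)\<^sup>*\<^sup>* \<sigma> (fold upd w \<sigma>)"
  proof (induction arbitrary: \<sigma>)
    case (app u v)
    then have "run x L \<sigma> (fold upd u \<sigma>)" by (auto simp: run_def valid_append)
    moreover have "(run x L)\<^sup>*\<^sup>* (fold upd u \<sigma>) (fold upd v (fold upd u \<sigma>))"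
      using app by (simp add: valid_append)
    ultimately show ?case by (simp add: converse_rtranclp_into_rtranclp)
  qed simp
  with w(3) show "(run x L)\<^sup>*\<^sup>* \<sigma> \<tau>" by simp
next
  fix \<sigma> \<tau>
  assume "(run x L)\<^sup>*\<^sup>* \<sigma> \<tau>"
  then show "run x (star L) \<sigma> \<tau>"
  proof (induction rule: converse_rtranclp_induct)
    case base
    then show ?case unfolding run_def by (intro bexI[of _ "[]"]) (auto intro: star.intros)
  next
    case (step \<sigma> \<rho>)
    then obtain u v where "u \<in> L" "valid x u \<sigma>" "\<rho> = fold upd u \<sigma>"
      "v \<in> star L" "valid x v \<rho>" "\<tau> = fold upd v \<rho>" unfolding run_def by blast
    then show ?case unfolding run_def
      by (intro bexI[of _ "u @ v"]) (auto simp: valid_append intro: star.app)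
  qed
qed

lemma prog_empty: "prog {}"
  by (simp add: prog_def regular_empty)

lemma prog_singleton: "prog {[a]}"
proof -
  have "finite (regs a)" by (cases a) auto
  then have "regs a \<subseteq> {..<Suc (Max (regs a))}" by (auto simp: less_Suc_eq_le)
  then show ?thesis unfolding prog_def by (auto simp: regular_singleton)
qed

lemma prog_conc: 
  assumes "prog K" "prog L"
  shows "prog (conc K L)"
proof -
  obtain M N where "\<forall>w\<in>K. \<forall>a\<in>set w. regs a \<subseteq> {..<M}" "\<forall>w\<in>L. \<forall>a\<in>set w. regs a \<subseteq> {..<N}"
    using assms unfolding prog_def by blast
  then have "\<forall>w\<in>conc K L. \<forall>a\<in>set w. regs a \<subseteq> {..<max M N}"
    unfolding conc_def by (fastforce simp: less_max_iff_disj subset_iff)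
  then show ?thesis using assms regular_conc unfolding prog_def by blast
qed

lemma prog_star: 
  assumes "prog L"
  shows "prog (star L)"
proof -
  obtain N where N: "\<forall>w\<in>L. \<forall>a\<in>set w. regs a \<subseteq> {..<N}"
    using assms unfolding prog_def by blast
  have "\<forall>a\<in>set w. regs a \<subseteq> {..<N}" if "w \<in> star L" for w
    using that by induction (use N in auto)
  then show ?thesis using assms regular_star unfolding prog_def by blast
qed

lemmas prog_intros = prog_empty prog_singleton prog_conc prog_star

text \<open>\<open>impl rs s n R\<close>: some program reads the registers \<open>rs\<close>, leaves all registers below \<open>s\<close> alone and
  puts into the \<open>n\<close> registers from \<open>s\<close> on exactly the vectors that \<open>R\<close> allows.\<close>

definition implements :: "op list set \<Rightarrow> nat list \<Rightarrow> nat \<Rightarrow> nat \<Rightarrow> (nat list \<Rightarrow> nat list \<Rightarrow> bool) \<Rightarrow> bool" where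
  "implements L rs s n R \<longleftrightarrow> (\<forall>x \<sigma>. \<sigma> 1 = 0 \<longrightarrow>
     (\<forall>\<tau>. run x L \<sigma> \<tau> \<longrightarrow> (\<forall>k<s. \<tau> k = \<sigma> k) \<and> R (map \<sigma> rs) (map \<tau> [s..<s + n])) \<and>
     (\<forall>ys. R (map \<sigma> rs) ys \<longrightarrow> (\<exists>\<tau>. run x L \<sigma> \<tau> \<and> map \<tau> [s..<s + n] = ys)))"

definition impl :: "nat list \<Rightarrow> nat \<Rightarrow> nat \<Rightarrow> (nat list \<Rightarrow> nat list \<Rightarrow> bool) \<Rightarrow> bool" where
  "impl rs s n R \<longleftrightarrow> (\<exists>L. prog L \<and> implements L rs s n R)"

section \<open>Programs for partial recursive functions\<close>

lemma prog_Nil: "prog {[]}"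
  by (simp add: prog_def regular_singleton)

lemma run_Nil [simp]: "run x {[]} \<sigma> \<tau> \<longleftrightarrow> \<tau> = \<sigma>"
  by (simp add: run_def)

lemma implements_sound:
  assumes "implements L rs s n R" "\<sigma> 1 = 0" "run x L \<sigma> \<tau>"
  shows "k < s \<Longrightarrow> \<tau> k = \<sigma> k" "R (map \<sigma> rs) (map \<tau> [s..<s + n])"
  using assms unfolding implements_def by blast+

lemma implements_complete:
  assumes "implements L rs s n R" "\<sigma> 1 = 0" "R (map \<sigma> rs) ys"
  shows "\<exists>\<tau>. run x L \<sigma> \<tau> \<and> map \<tau> [s..<s + n] = ys \<and> (\<forall>k<s. \<tau> k = \<sigma> k)"
  using assms unfolding implements_def by blast

lemma implements_single_complete:
  assumes "implements L rs s 1 (\<lambda>xs ys. \<exists>y. ys = [y] \<and> P xs y)" "\<sigma> 1 = 0" "P (map \<sigma> rs) y"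
  shows "\<exists>\<tau>. run x L \<sigma> \<tau> \<and> \<tau> s = y \<and> (\<forall>k<s. \<tau> k = \<sigma> k)"
  using implements_complete[OF assms(1), where \<sigma> = \<sigma> and ys = "[y]" and x = x] assms(2,3) by simp

lemma implementsI:
  assumes "\<And>x \<sigma> \<tau> k. \<sigma> 1 = 0 \<Longrightarrow> run x L \<sigma> \<tau> \<Longrightarrow> k < s \<Longrightarrow> \<tau> k = \<sigma> k"
    and "\<And>x \<sigma> \<tau>. \<sigma> 1 = 0 \<Longrightarrow> run x L \<sigma> \<tau> \<Longrightarrow> R (map \<sigma> rs) (map \<tau> [s..<s + n])"
    and "\<And>x \<sigma> ys. \<sigma> 1 = 0 \<Longrightarrow> R (map \<sigma> rs) ys \<Longrightarrow> \<exists>\<tau>. run x L \<sigma> \<tau> \<and> map \<tau> [s..<s + n] = ys"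
  shows "implements L rs s n R"
  using assms unfolding implements_def by blast

lemma implI: "implements L rs s n R \<Longrightarrow> prog L \<Longrightarrow> impl rs s n R"
  unfolding impl_def by blast

lemma map_regs_cong: "(\<And>k. k < s \<Longrightarrow> \<tau> k = \<sigma> k) \<Longrightarrow> set rs \<subseteq> {..<s} \<Longrightarrow> map \<tau> rs = map \<sigma> rs"
  by (auto intro!: map_cong)

lemma impl_Nil: "impl rs s 0 (\<lambda>_ ys. ys = [])"
  unfolding impl_def by (rule exI[of _ "{[]}"]) (auto intro: implementsI prog_Nil)

text \<open>Both programs read the same \<open>rs\<close>. The first one cannot disturb them because
  they lie below \<open>s\<close>, and the second one writes only from \<open>s + n\<close> on,
  above the outputs of the first.\<close>

lemma impl_append:
  assumes "impl rs s n R" "impl rs (s + n) m R'" "set rs \<subseteq> {..<s}" "1 < s"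
  shows "impl rs s (n + m) (\<lambda>xs zs. \<exists>ys ys'. zs = ys @ ys' \<and> R xs ys \<and> R' xs ys')"
proof -
  obtain K L where K: "prog K" "implements K rs s n R" and L: "prog L" "implements L rs (s + n) m R'"
    using assms(1,2) unfolding impl_def by blast
  have upt: "[s..<s + (n + m)] = [s..<s + n] @ [s + n..<s + n + m]"
    using upt_add_eq_append[of s "s + n" m] by (simp add: add.assoc)
  have "implements (conc K L) rs s (n + m) (\<lambda>xs zs. \<exists>ys ys'. zs = ys @ ys' \<and> R xs ys \<and> R' xs ys')"
  proof (rule implementsI)
    fix x \<sigma> \<tau> assume \<sigma>: "\<sigma> 1 = (0::nat)" "run x (conc K L) \<sigma> \<tau>"
    then obtain \<rho> where \<rho>: "run x K \<sigma> \<rho>" "run x L \<rho> \<tau>" by auto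
    note 1 = implements_sound[OF K(2), where \<sigma> = \<sigma>, OF \<sigma>(1) \<rho>(1)]
    have "\<rho> 1 = 0" using 1(1) \<sigma>(1) assms(4) by simp
    note 2 = implements_sound[OF L(2), where \<sigma> = \<rho>, OF this \<rho>(2)]
    show "\<tau> k = \<sigma> k" if "k < s" for k using that 1(1) 2(1) by simp
    have eq: "map \<tau> [s..<s + n] = map \<rho> [s..<s + n]" by (rule map_regs_cong[of "s + n" \<tau> \<rho>, OF 2(1)]) auto
    have "map \<rho> rs = map \<sigma> rs" by (rule map_regs_cong[OF 1(1) assms(3)])
    then show "\<exists>ys ys'. map \<tau> [s..<s + (n + m)] = ys @ ys' \<and> R (map \<sigma> rs) ys \<and> R' (map \<sigma> rs) ys'"
      unfolding upt map_append eq using 1(2) 2(2) by metis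
  next
    fix x \<sigma> zs
    assume \<sigma>: "\<sigma> 1 = (0::nat)" "\<exists>ys ys'. zs = ys @ ys' \<and> R (map \<sigma> rs) ys \<and> R' (map \<sigma> rs) ys'"
    then obtain ys ys' where zs: "zs = ys @ ys'" "R (map \<sigma> rs) ys" "R' (map \<sigma> rs) ys'" by blast
    obtain \<rho> where \<rho>: "run x K \<sigma> \<rho>" "map \<rho> [s..<s + n] = ys" "\<And>k. k < s \<Longrightarrow> \<rho> k = \<sigma> k"
      using implements_complete[OF K(2), where x = x and \<sigma> = \<sigma>, OF \<sigma>(1) zs(2)] by blast
    have "map \<rho> rs = map \<sigma> rs" by (rule map_regs_cong[OF \<rho>(3) assms(3)])
    then have "R' (map \<rho> rs) ys'" using zs(3) by (simp del: map_eq_conv)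
    moreover have "\<rho> 1 = 0" using \<rho>(3) \<sigma>(1) assms(4) by simp
    ultimately obtain \<tau>
      where \<tau>: "run x L \<rho> \<tau>" "map \<tau> [s + n..<s + n + m] = ys'" "\<And>k. k < s + n \<Longrightarrow> \<tau> k = \<rho> k"
      using implements_complete[OF L(2)] by metis
    have "map \<tau> [s..<s + n] = map \<rho> [s..<s + n]" by (rule map_regs_cong[of "s + n" \<tau> \<rho>, OF \<tau>(3)]) auto
    then have "map \<tau> [s..<s + (n + m)] = zs" unfolding upt map_append using \<tau>(2) \<rho>(2) zs(1) by simp
    then show "\<exists>\<tau>. run x (conc K L) \<sigma> \<tau> \<and> map \<tau> [s..<s + (n + m)] = zs"
      using \<rho>(1) \<tau>(1) by auto
  qed
  then show ?thesis by (rule implI) (intro prog_intros K(1) L(1))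
qed

lemma impl_list:
  assumes "\<And>R s'. R \<in> set Rs \<Longrightarrow> s \<le> s' \<Longrightarrow> impl rs s' 1 (\<lambda>xs ys. \<exists>y. ys = [y] \<and> R xs y)"
    and "set rs \<subseteq> {..<s}" "1 < s"
  shows "impl rs s (length Rs) (\<lambda>xs. list_all2 (\<lambda>R y. R xs y) Rs)"
  using assms
proof (induction Rs arbitrary: s)
  case Nil
  then show ?case using impl_Nil by simp
next
  case (Cons R Rs)
  have "impl rs (s + 1) (length Rs) (\<lambda>xs. list_all2 (\<lambda>R y. R xs y) Rs)"
    using Cons.prems by (intro Cons.IH) auto
  moreover have "impl rs s 1 (\<lambda>xs ys. \<exists>y. ys = [y] \<and> R xs y)"
    using Cons.prems(1) by simp
  ultimately have "impl rs s (1 + length Rs) (\<lambda>xs zs. \<exists>ys ys'. zs = ys @ ys' \<and>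
      (\<exists>y. ys = [y] \<and> R xs y) \<and> list_all2 (\<lambda>R y. R xs y) Rs ys')"
    using impl_append Cons.prems(2,3) by blast
  moreover have "(\<exists>ys ys'. zs = ys @ ys' \<and> (\<exists>y. ys = [y] \<and> R xs y) \<and> list_all2 (\<lambda>R y. R xs y) Rs ys')
      \<longleftrightarrow> list_all2 (\<lambda>R y. R xs y) (R # Rs) zs" for xs zs
    unfolding list_all2_Cons1 by (metis append_Cons append_Nil)
  ultimately show ?case by simp
qed

text \<open>The intermediate vector occupies the registers from \<open>s\<close> on and the result
  arrives at \<open>s + n\<close>. Everything from \<open>s\<close> on is scratch space, so the
  final copy may overwrite the vector.\<close>

lemma impl_then:
  assumes "impl rs s n R" "impl [s..<s + n] (s + n) 1 (\<lambda>ys zs. \<exists>z. zs = [z] \<and> R' ys z)" "1 < s"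
  shows "impl rs s 1 (\<lambda>xs zs. \<exists>z. zs = [z] \<and> (\<exists>ys. R xs ys \<and> R' ys z))"
proof -
  obtain K L where K: "prog K" "implements K rs s n R" and L: "prog L"
    "implements L [s..<s + n] (s + n) 1 (\<lambda>ys zs. \<exists>z. zs = [z] \<and> R' ys z)"
    using assms(1,2) unfolding impl_def by blast
  let ?L = "conc K (conc L {[Copy s (s + n)]})"
  have "implements ?L rs s 1 (\<lambda>xs zs. \<exists>z. zs = [z] \<and> (\<exists>ys. R xs ys \<and> R' ys z))"
  proof (rule implementsI)
    fix x \<sigma> \<tau> assume \<sigma>: "\<sigma> 1 = (0::nat)" "run x ?L \<sigma> \<tau>"
    then obtain \<rho> \<tau>' where \<rho>: "run x K \<sigma> \<rho>" "run x L \<rho> \<tau>'" "\<tau> = \<tau>'(s := \<tau>' (s + n))" by auto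
    note 1 = implements_sound[OF K(2), where \<sigma> = \<sigma>, OF \<sigma>(1) \<rho>(1)]
    have "\<rho> 1 = 0" using 1(1) \<sigma>(1) assms(3) by simp
    note 2 = implements_sound[OF L(2), where \<sigma> = \<rho>, OF this \<rho>(2)]
    show "\<tau> k = \<sigma> k" if "k < s" for k using that 1(1) 2(1) \<rho>(3) by simp
    show "\<exists>z. map \<tau> [s..<s + 1] = [z] \<and> (\<exists>ys. R (map \<sigma> rs) ys \<and> R' ys z)"
      using 1(2) 2(2) \<rho>(3) by auto
  next
    fix x \<sigma> zs
    assume \<sigma>: "\<sigma> 1 = (0::nat)" "\<exists>z. zs = [z] \<and> (\<exists>ys. R (map \<sigma> rs) ys \<and> R' ys z)"
    then obtain ys z where zs: "zs = [z]" "R (map \<sigma> rs) ys" "R' ys z" by blast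
    obtain \<rho> where \<rho>: "run x K \<sigma> \<rho>" "map \<rho> [s..<s + n] = ys" "\<And>k. k < s \<Longrightarrow> \<rho> k = \<sigma> k"
      using implements_complete[OF K(2), where x = x and \<sigma> = \<sigma>, OF \<sigma>(1) zs(2)] by blast
    have "\<rho> 1 = 0" "R' (map \<rho> [s..<s + n]) z"
      using \<rho>(2,3) \<sigma>(1) assms(3) zs(3) by auto
    then obtain \<tau> where \<tau>: "run x L \<rho> \<tau>" "\<tau> (s + n) = z"
      using implements_single_complete[OF L(2)] by blast
    then show "\<exists>\<tau>. run x ?L \<sigma> \<tau> \<and> map \<tau> [s..<s + 1] = zs"
      using \<rho>(1) zs(1) by (intro exI[of _ "\<tau>(s := \<tau> (s + n))"]) auto
  qed
  then show ?thesis by (rule implI) (intro prog_intros K(1) L(1))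
qed

text \<open>The loop runs an arbitrary number of times and nothing makes it stop in time; the two
  guards at the end keep only the runs whose counter equals the recursion argument.\<close>

lemma impl_PrimRec:
  assumes f: "impl rs (s + 2) 1 (\<lambda>xs ys. \<exists>y. ys = [y] \<and> rec_eval f xs y)"
    and g: "impl (Suc s # s # rs) (s + 2) 1 (\<lambda>xs ys. \<exists>y. ys = [y] \<and> rec_eval g xs y)"
    and rs: "set (r # rs) \<subseteq> {..<s}" and s: "1 < s"
  shows "impl (r # rs) s 1 (\<lambda>xs ys. \<exists>y. ys = [y] \<and> rec_eval (PrimRec f g) xs y)"
proof -
  obtain F where F: "prog F" "implements F rs (s + 2) 1 (\<lambda>xs ys. \<exists>y. ys = [y] \<and> rec_eval f xs y)"
    using f unfolding impl_def by blast
  obtain G where G: "prog G"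
    "implements G (Suc s # s # rs) (s + 2) 1 (\<lambda>xs ys. \<exists>y. ys = [y] \<and> rec_eval g xs y)"
    using g unfolding impl_def by blast
  \<comment> \<open>Register \<open>s\<close> holds the current value, \<open>Suc s\<close> the
    counter and \<open>s + 2\<close> the result of a call. Register 1 supplies the zero for the
    counter.\<close>
  let ?S = "conc F (conc {[Copy s (s + 2)]} {[Copy (Suc s) 1]})"
  let ?B = "conc G (conc {[Copy s (s + 2)]} {[Inc (Suc s)]})"
  let ?E = "conc {[Leq (Suc s) r]} {[Leq r (Suc s)]}"
  let ?L = "conc ?S (conc (star ?B) ?E)"
  define I where "I \<sigma> \<tau> \<longleftrightarrow> (\<forall>k<s. \<tau> k = \<sigma> k) \<and>
    rec_eval (PrimRec f g) (\<tau> (Suc s) # map \<sigma> rs) (\<tau> s)" for \<sigma> \<tau> :: "nat \<Rightarrow> nat"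
  have S: "I \<sigma> \<tau>" if "\<sigma> 1 = 0" "run x ?S \<sigma> \<tau>" for x \<sigma> \<tau>
  proof -
    from that(2) obtain \<rho> where \<rho>: "run x F \<sigma> \<rho>" "\<tau> = (\<rho>(s := \<rho> (s + 2)))(Suc s := \<rho> 1)"
      using s by auto
    note 1 = implements_sound[OF F(2), where \<sigma> = \<sigma>, OF that(1) \<rho>(1)]
    show ?thesis using 1 \<rho>(2) s that(1) by (auto simp: I_def intro: rec_eval.prim_0)
  qed
  have B: "I \<sigma> \<tau>'" if "\<sigma> 1 = 0" "I \<sigma> \<tau>" "run x ?B \<tau> \<tau>'" for x \<sigma> \<tau> \<tau>'
  proof -
    from that(3) obtain \<rho> where \<rho>: "run x G \<tau> \<rho>"
      "\<tau>' = (\<rho>(s := \<rho> (s + 2)))(Suc s := Suc (\<rho> (Suc s)))" by auto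
    have "\<tau> 1 = 0" using that s by (simp add: I_def)
    note 1 = implements_sound[OF G(2), where \<sigma> = \<tau>, OF this \<rho>(1)]
    have "map \<tau> rs = map \<sigma> rs" using that(2) rs by (auto simp: I_def)
    then have "rec_eval (PrimRec f g) (Suc (\<tau> (Suc s)) # map \<sigma> rs) (\<rho> (s + 2))"
      using 1(2) that(2) by (intro rec_eval.prim_Suc[of _ _ _ _ "\<tau> s"]) (simp_all add: I_def del: map_eq_conv)
    then show ?thesis using 1(1) \<rho>(2) s that(2) by (simp add: I_def)
  qed
  have star: "I \<sigma> \<tau>'" if "\<sigma> 1 = 0" "(run x ?B)\<^sup>*\<^sup>* \<tau> \<tau>'" "I \<sigma> \<tau>" for x \<sigma> \<tau> \<tau>'
    using that(2,3) by induction (use B[where \<sigma>=\<sigma>, OF that(1)] in blast)+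
  have complete: "\<exists>\<rho> \<tau>. run x ?S \<sigma> \<rho> \<and> (run x ?B)\<^sup>*\<^sup>* \<rho> \<tau> \<and> I \<sigma> \<tau> \<and> \<tau> (Suc s) = n \<and> \<tau> s = y"
    if "\<sigma> 1 = 0" "rec_eval (PrimRec f g) (n # map \<sigma> rs) y" for x \<sigma> n y
    using that(2)
  proof (induction n arbitrary: y)
    note \<sigma> = that(1)
    case 0
    then have "rec_eval f (map \<sigma> rs) y" by (rule rec_eval_cases(5))
    then obtain \<rho>
      where \<rho>: "run x F \<sigma> \<rho>" "\<rho> (s + 2) = y" "\<And>k. k < s + 2 \<Longrightarrow> \<rho> k = \<sigma> k"
      using implements_single_complete[OF F(2), where \<sigma> = \<sigma> and x = x, OF \<sigma>] by blast
    let ?\<tau> = "(\<rho>(s := \<rho> (s + 2)))(Suc s := \<rho> 1)"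
    have 1: "run x ?S \<sigma> ?\<tau>" using \<rho>(1) s by auto
    show ?case
      by (intro exI conjI, rule 1, rule rtranclp.rtrancl_refl, rule S[where \<sigma> = \<sigma>, OF \<sigma> 1])
        (use \<rho> s \<sigma> in simp_all)
  next
    case (Suc n)
    from Suc.prems obtain z where z: "rec_eval (PrimRec f g) (n # map \<sigma> rs) z"
      "rec_eval g (n # z # map \<sigma> rs) y" by (auto elim: rec_eval_cases(6))
    from Suc.IH[OF z(1)] obtain \<rho> \<tau> where \<tau>: "run x ?S \<sigma> \<rho>" "(run x ?B)\<^sup>*\<^sup>* \<rho> \<tau>" "I \<sigma> \<tau>"
      "\<tau> (Suc s) = n" "\<tau> s = z" by blast
    have "map \<tau> rs = map \<sigma> rs" using \<tau>(3) rs by (auto simp: I_def)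
    then have "rec_eval g (map \<tau> (Suc s # s # rs)) y" using z(2) \<tau>(4,5) by (simp del: map_eq_conv)
    moreover have "\<tau> 1 = 0" using \<tau>(3) s that(1) by (simp add: I_def)
    ultimately obtain \<tau>' where \<tau>': "run x G \<tau> \<tau>'" "\<tau>' (s + 2) = y"
      "\<And>k. k < s + 2 \<Longrightarrow> \<tau>' k = \<tau> k"
      using implements_single_complete[OF G(2)] by blast
    let ?\<tau> = "(\<tau>'(s := \<tau>' (s + 2)))(Suc s := Suc (\<tau>' (Suc s)))"
    have 1: "run x ?B \<tau> ?\<tau>" using \<tau>'(1) s by auto
    have "(run x ?B)\<^sup>*\<^sup>* \<rho> ?\<tau>" using \<tau>(2) 1 by (rule rtranclp.rtrancl_into_rtrancl[of "run x ?B"])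
    show ?case
      by (intro exI conjI, rule \<tau>(1), fact, rule B[where \<sigma> = \<sigma>, OF that(1) \<tau>(3) 1])
        (use \<tau> \<tau>' in simp_all)
  qed
  have "implements ?L (r # rs) s 1 (\<lambda>xs ys. \<exists>y. ys = [y] \<and> rec_eval (PrimRec f g) xs y)"
  proof (rule implementsI)
    fix x \<sigma> \<tau> assume \<sigma>: "\<sigma> 1 = (0::nat)" "run x ?L \<sigma> \<tau>"
    then obtain \<rho> \<tau>' where "run x ?S \<sigma> \<rho>" "(run x ?B)\<^sup>*\<^sup>* \<rho> \<tau>'" "run x ?E \<tau>' \<tau>"
      unfolding run_conc[of _ ?S] run_conc[of _ "star ?B"] run_star by blast
    moreover from this(3) have "\<tau>' = \<tau>" "\<tau> (Suc s) = \<tau> r" by auto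
    ultimately have \<rho>: "run x ?S \<sigma> \<rho>" "(run x ?B)\<^sup>*\<^sup>* \<rho> \<tau>" "\<tau> (Suc s) = \<tau> r" by simp_all
    have I: "I \<sigma> \<tau>" by (rule star[where \<sigma>=\<sigma>, OF \<sigma>(1) \<rho>(2) S[where \<sigma>=\<sigma>, OF \<sigma>(1) \<rho>(1)]])
    show "\<tau> k = \<sigma> k" if "k < s" for k using that I by (simp add: I_def)
    note \<rho>(3)
    also have "\<tau> r = \<sigma> r" using I rs by (simp add: I_def)
    finally show "\<exists>y. map \<tau> [s..<s + 1] = [y] \<and> rec_eval (PrimRec f g) (map \<sigma> (r # rs)) y"
      using I by (simp add: I_def)
  next
    fix x \<sigma> ys
    assume \<sigma>: "\<sigma> 1 = (0::nat)" "\<exists>y. ys = [y] \<and> rec_eval (PrimRec f g) (map \<sigma> (r # rs)) y"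
    then obtain y where y: "ys = [y]" "rec_eval (PrimRec f g) (\<sigma> r # map \<sigma> rs) y" by auto
    from complete[OF \<sigma>(1) y(2), of x] obtain \<rho> \<tau> where \<tau>: "run x ?S \<sigma> \<rho>" "(run x ?B)\<^sup>*\<^sup>* \<rho> \<tau>"
      "I \<sigma> \<tau>" "\<tau> (Suc s) = \<sigma> r" "\<tau> s = y" by blast
    have "\<tau> r = \<sigma> r" using \<tau>(3) rs by (simp add: I_def)
    then have "run x ?E \<tau> \<tau>" using \<tau>(4) by simp
    then have "run x ?L \<sigma> \<tau>" using \<tau>(1,2) unfolding run_conc[of _ ?S] run_conc[of _ "star ?B"] run_star
      by blast
    moreover have "map \<tau> [s..<s + 1] = ys" using \<tau>(5) y(1) by simp
    ultimately show "\<exists>\<tau>. run x ?L \<sigma> \<tau> \<and> map \<tau> [s..<s + 1] = ys" by blast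
  qed
  then show ?thesis by (rule implI) (intro prog_intros F(1) G(1))
qed

text \<open>Each round certifies that \<open>f\<close> is defined and positive at the current
  candidate, which is exactly what \<open>rec_eval.mu\<close> demands of the smaller arguments.
  Where \<open>f\<close> is undefined, its program has no run and the search gets stuck.\<close>

lemma impl_Mu:
  assumes f: "impl (s # rs) (s + 1) 1 (\<lambda>xs ys. \<exists>y. ys = [y] \<and> rec_eval f xs y)"
    and rs: "set rs \<subseteq> {..<s}" and s: "1 < s"
  shows "impl rs s 1 (\<lambda>xs ys. \<exists>y. ys = [y] \<and> rec_eval (Mu f) xs y)"
proof -
  obtain F where F: "prog F"
    "implements F (s # rs) (s + 1) 1 (\<lambda>xs ys. \<exists>y. ys = [y] \<and> rec_eval f xs y)"
    using f unfolding impl_def by blast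
  let ?S = "{[Copy s 1]}"
  \<comment> \<open>Register \<open>s + 2\<close> is set to 1, so that the only available comparison
    can test the value in \<open>s + 1\<close> for being positive.\<close>
  let ?T = "conc {[Copy (s + 2) 1]} (conc {[Inc (s + 2)]} (conc {[Leq (s + 2) (s + 1)]} {[Inc s]}))"
  let ?B = "conc F ?T"
  let ?E = "conc F {[Leq (s + 1) 1]}"
  let ?L = "conc ?S (conc (star ?B) ?E)"
  define I where "I \<sigma> \<tau> \<longleftrightarrow> (\<forall>k<s. \<tau> k = \<sigma> k) \<and>
    (\<forall>m<\<tau> s. \<exists>k. rec_eval f (m # map \<sigma> rs) (Suc k))" for \<sigma> \<tau> :: "nat \<Rightarrow> nat"
  have eq: "map \<tau> rs = map \<sigma> rs" "\<sigma> 1 = 0 \<Longrightarrow> \<tau> 1 = 0" if "I \<sigma> \<tau>" for \<sigma> \<tau>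
    using that rs s by (auto simp: I_def)
  have B: "I \<sigma> \<tau>'" if "\<sigma> 1 = 0" "I \<sigma> \<tau>" "run x ?B \<tau> \<tau>'" for x \<sigma> \<tau> \<tau>'
  proof -
    from that(3) s obtain \<rho> where \<rho>: "run x F \<tau> \<rho>" "Suc (\<rho> 1) \<le> \<rho> (s + 1)"
      "\<tau>' = (\<rho>(s + 2 := Suc (\<rho> 1)))(s := Suc (\<rho> s))" by auto
    note 1 = implements_sound[OF F(2), where \<sigma> = \<tau>, OF eq(2)[OF that(2,1)] \<rho>(1)]
    have "\<rho> (s + 1) = Suc (\<rho> (s + 1) - 1)" "\<rho> s = \<tau> s" using \<rho>(2) 1(1) by auto
    moreover have "rec_eval f (\<tau> s # map \<sigma> rs) (\<rho> (s + 1))"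
      using 1(2) eq(1)[OF that(2)] by simp
    ultimately have "\<exists>k. rec_eval f (\<tau> s # map \<sigma> rs) (Suc k)" by metis
    then show ?thesis using 1(1) \<rho>(3) that(2) by (auto simp: I_def less_Suc_eq)
  qed
  have star: "I \<sigma> \<tau>'" if "\<sigma> 1 = 0" "(run x ?B)\<^sup>*\<^sup>* \<tau> \<tau>'" "I \<sigma> \<tau>" for x \<sigma> \<tau> \<tau>'
    using that(2,3) by induction (use B[where \<sigma>=\<sigma>, OF that(1)] in blast)+
  have loop: "\<exists>\<tau>. (run x ?B)\<^sup>*\<^sup>* (\<sigma>(s := 0)) \<tau> \<and> I \<sigma> \<tau> \<and> \<tau> s = n"
    if "\<sigma> 1 = 0" "\<forall>m<n. \<exists>k. rec_eval f (m # map \<sigma> rs) (Suc k)" for x \<sigma> n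
    using that(2)
  proof (induction n)
    case 0
    show ?case by (rule exI[of _ "\<sigma>(s := 0)"]) (simp add: I_def)
  next
    case (Suc n)
    then obtain \<tau> where \<tau>: "(run x ?B)\<^sup>*\<^sup>* (\<sigma>(s := 0)) \<tau>" "I \<sigma> \<tau>" "\<tau> s = n"
      using less_SucI by blast
    from Suc.prems obtain k where k: "rec_eval f (n # map \<sigma> rs) (Suc k)" by blast
    note \<tau>1 = eq(2)[OF \<tau>(2) that(1)]
    have "rec_eval f (map \<tau> (s # rs)) (Suc k)" using \<tau>(3) k eq(1)[OF \<tau>(2)] by (simp del: map_eq_conv)
    then obtain \<rho>
      where \<rho>: "run x F \<tau> \<rho>" "\<rho> (s + 1) = Suc k" "\<And>k. k < s + 1 \<Longrightarrow> \<rho> k = \<tau> k"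
      using implements_single_complete[OF F(2), where \<sigma> = \<tau> and x = x, OF \<tau>1] by blast
    let ?\<rho> = "(\<rho>(s + 2 := Suc (\<rho> 1)))(s := Suc (\<rho> s))"
    have "\<rho> 1 = 0" using \<rho>(3) eq(2)[OF \<tau>(2) that(1)] s by simp
    then have 1: "run x ?B \<tau> ?\<rho>" using \<rho>(1,2) s by (auto intro!: exI[of _ \<rho>])
    have "(run x ?B)\<^sup>*\<^sup>* (\<sigma>(s := 0)) ?\<rho>" using \<tau>(1) 1 by (rule rtranclp.rtrancl_into_rtrancl[of "run x ?B"])
    then show ?case
      by (intro exI conjI, assumption, intro B[where \<sigma> = \<sigma>, OF that(1) \<tau>(2) 1])
        (use \<tau>(3) \<rho>(3) in simp)
  qed
  have "implements ?L rs s 1 (\<lambda>xs ys. \<exists>y. ys = [y] \<and> rec_eval (Mu f) xs y)"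
  proof (rule implementsI)
    fix x \<sigma> \<tau> assume \<sigma>: "\<sigma> 1 = (0::nat)" "run x ?L \<sigma> \<tau>"
    then obtain \<rho> where \<rho>: "(run x ?B)\<^sup>*\<^sup>* (\<sigma>(s := 0)) \<rho>" "run x F \<rho> \<tau>" "\<tau> (s + 1) \<le> \<tau> 1"
      unfolding run_conc[of _ ?S] run_conc[of _ "star ?B"] run_star run_singleton
        run_conc[of _ F "{[Leq (s + 1) 1]}"] by auto
    have I: "I \<sigma> \<rho>" by (rule star[where \<sigma>=\<sigma>, OF \<sigma>(1) \<rho>(1)]) (simp add: I_def)
    note 1 = implements_sound[OF F(2), where \<sigma> = \<rho>, OF eq(2)[OF I \<sigma>(1)] \<rho>(2)]
    show 2: "\<tau> k = \<sigma> k" if "k < s" for k using that I 1(1) by (simp add: I_def)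
    have "\<tau> (s + 1) = 0" using \<rho>(3) 2 s \<sigma>(1) by simp
    then have "rec_eval f (\<rho> s # map \<sigma> rs) 0" using 1(2) eq(1)[OF I] by simp
    then have "rec_eval (Mu f) (map \<sigma> rs) (\<rho> s)" using I by (intro rec_eval.mu) (auto simp: I_def)
    then show "\<exists>y. map \<tau> [s..<s + 1] = [y] \<and> rec_eval (Mu f) (map \<sigma> rs) y" using 1(1) by simp
  next
    fix x \<sigma> ys
    assume \<sigma>: "\<sigma> 1 = (0::nat)" "\<exists>y. ys = [y] \<and> rec_eval (Mu f) (map \<sigma> rs) y"
    then obtain y where y: "ys = [y]" "rec_eval (Mu f) (map \<sigma> rs) y" by auto
    then have y': "rec_eval f (y # map \<sigma> rs) 0" "\<forall>m<y. \<exists>k. rec_eval f (m # map \<sigma> rs) (Suc k)"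
      by (auto elim: rec_eval_cases(7))
    from loop[OF \<sigma>(1) y'(2), of x] obtain \<rho> where \<rho>: "(run x ?B)\<^sup>*\<^sup>* (\<sigma>(s := 0)) \<rho>" "I \<sigma> \<rho>" "\<rho> s = y"
      by blast
    have "rec_eval f (map \<rho> (s # rs)) 0" using y'(1) \<rho>(3) eq(1)[OF \<rho>(2)] by (simp del: map_eq_conv)
    then obtain \<tau> where \<tau>: "run x F \<rho> \<tau>" "\<tau> (s + 1) = 0" "\<And>k. k < s + 1 \<Longrightarrow> \<tau> k = \<rho> k"
      using implements_single_complete[OF F(2), where \<sigma> = \<rho> and x = x, OF eq(2)[OF \<rho>(2) \<sigma>(1)]] by blast
    have "run x ?E \<rho> \<tau>" using \<tau>(1,2) by auto
    moreover have "run x ?S \<sigma> (\<sigma>(s := 0))" using \<sigma>(1) by simp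
    ultimately have "run x ?L \<sigma> \<tau>"
      using \<rho>(1) unfolding run_conc[of _ ?S] run_conc[of _ "star ?B"] run_star by blast
    moreover have "map \<tau> [s..<s + 1] = ys" using \<tau>(3) \<rho>(3) y(1) by simp
    ultimately show "\<exists>\<tau>. run x ?L \<sigma> \<tau> \<and> map \<tau> [s..<s + 1] = ys" by blast
  qed
  then show ?thesis by (rule implI) (intro prog_intros F(1))
qed

text \<open>Serves the arity mismatches, where a \<open>recf\<close> term is undefined: the program
  without words has no run at all.\<close>

lemma impl_False: 
  assumes "\<And>xs ys. length xs = length rs \<Longrightarrow> \<not> R xs ys"
  shows "impl rs s n R"
  unfolding impl_def
  by (rule exI[of _ "{}"]) (use assms in \<open>auto simp: implements_def intro: prog_empty\<close>)

lemma rec_eval_Zero_iff: "rec_eval Zero xs y \<longleftrightarrow> y = 0"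
  by (auto elim: rec_eval_cases(1) intro: rec_eval.zero)

lemma rec_eval_Succ_iff: "rec_eval Succ xs y \<longleftrightarrow> (\<exists>x. xs = [x] \<and> y = Suc x)"
  by (auto elim: rec_eval_cases(2) intro: rec_eval.succ)

lemma rec_eval_Proj_iff: "rec_eval (Proj i) xs y \<longleftrightarrow> i < length xs \<and> y = xs ! i"
  by (auto elim: rec_eval_cases(3) intro: rec_eval.proj)

lemma rec_eval_Comp_iff:
  "rec_eval (Comp f gs) xs z \<longleftrightarrow> (\<exists>ys. list_all2 (\<lambda>g. rec_eval g xs) gs ys \<and> rec_eval f ys z)"
  by (auto elim: rec_eval_cases(4) intro: rec_eval.comp)

text \<open>The input registers and the start of the scratch area must vary in the induction, since
  every subprogram is placed behind the data that its caller still needs.\<close>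

theorem impl_recf:
  assumes "set rs \<subseteq> {..<s}" "1 < s"
  shows "impl rs s 1 (\<lambda>xs ys. \<exists>y. ys = [y] \<and> rec_eval f xs y)"
  using assms
proof (induction f arbitrary: rs s)
  case Zero
  have "implements {[Copy s 1]} rs s 1 (\<lambda>xs ys. \<exists>y. ys = [y] \<and> rec_eval Zero xs y)"
    by (rule implementsI) (use Zero in \<open>auto simp: rec_eval_Zero_iff\<close>)
  then show ?case by (rule implI) (intro prog_intros)
next
  case Succ
  show ?case
  proof (cases "length rs = 1")
    case True
    then obtain r where r: "rs = [r]" by (auto simp: length_Suc_conv)
    have "implements (conc {[Copy s r]} {[Inc s]}) rs s 1 (\<lambda>xs ys. \<exists>y. ys = [y] \<and> rec_eval Succ xs y)"
      by (rule implementsI) (use Succ r in \<open>auto simp: rec_eval_Succ_iff\<close>)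
    then show ?thesis by (rule implI) (intro prog_intros)
  next
    case False
    then show ?thesis by (intro impl_False) (auto simp: rec_eval_Succ_iff)
  qed
next
  case (Proj i)
  show ?case
  proof (cases "i < length rs")
    case True
    have "implements {[Copy s (rs ! i)]} rs s 1 (\<lambda>xs ys. \<exists>y. ys = [y] \<and> rec_eval (Proj i) xs y)"
      by (rule implementsI) (use True in \<open>auto simp: rec_eval_Proj_iff\<close>)
    then show ?thesis by (rule implI) (intro prog_intros)
  next
    case False
    then show ?thesis by (intro impl_False) (auto simp: rec_eval_Proj_iff)
  qed
next
  case (Comp f gs)
  have "impl rs s (length (map rec_eval gs)) (\<lambda>xs. list_all2 (\<lambda>R y. R xs y) (map rec_eval gs))"
  proof (rule impl_list)
    fix R s' assume "R \<in> set (map rec_eval gs)" "s \<le> s'"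
    then obtain g where "g \<in> set gs" "R = rec_eval g" "set rs \<subseteq> {..<s'}" "1 < s'"
      using Comp.prems by fastforce
    then show "impl rs s' 1 (\<lambda>xs ys. \<exists>y. ys = [y] \<and> R xs y)" using Comp.IH(2) by blast
  qed (use Comp.prems in auto)
  moreover have "list_all2 (\<lambda>R y. R xs y) (map rec_eval gs) = list_all2 (\<lambda>g. rec_eval g xs) gs" for xs
    by (intro ext) (simp add: list_all2_map1)
  ultimately have 1: "impl rs s (length gs) (\<lambda>xs. list_all2 (\<lambda>g. rec_eval g xs) gs)" by simp
  have 2: "impl [s..<s + length gs] (s + length gs) 1 (\<lambda>xs ys. \<exists>y. ys = [y] \<and> rec_eval f xs y)"
    by (rule Comp.IH(1)) (use Comp.prems in auto)
  show ?case using impl_then[OF 1 2 Comp.prems(2)] by (simp add: rec_eval_Comp_iff)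
next
  case (PrimRec f g)
  show ?case
  proof (cases rs)
    case Nil
    then show ?thesis by (intro impl_False) (auto elim: rec_eval.cases)
  next
    case (Cons r rs')
    have "set rs' \<subseteq> {..<s + 2}" "set (Suc s # s # rs') \<subseteq> {..<s + 2}" "1 < s + 2"
      using PrimRec.prems Cons by fastforce+
    then show ?thesis unfolding Cons
      by (intro impl_PrimRec PrimRec.IH) (use PrimRec.prems Cons in auto)
  qed
next
  case (Mu f)
  have "set (s # rs) \<subseteq> {..<s + 1}" using Mu.prems by fastforce
  then show ?case by (intro impl_Mu Mu.IH) (use Mu.prems in auto)
qed

section \<open>Primitive recursive arithmetic\<close>

text \<open>Terms of type \<open>recf\<close> carry no arity, so it is fixed here; on lists of
  another length the term may do anything.\<close>

definition total_rec :: "nat \<Rightarrow> (nat list \<Rightarrow> nat) \<Rightarrow> bool" where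
  "total_rec n f \<longleftrightarrow> (\<exists>r. \<forall>xs. length xs = n \<longrightarrow> rec_eval r xs (f xs))"

lemma total_rec_proj: "i < n \<Longrightarrow> total_rec n (\<lambda>xs. xs ! i)"
  unfolding total_rec_def by (rule exI[of _ "Proj i"]) (simp add: rec_eval_Proj_iff)

lemma total_rec_Suc: 
  assumes "total_rec n f"
  shows "total_rec n (\<lambda>xs. Suc (f xs))"
proof -
  obtain r where r: "\<forall>xs. length xs = n \<longrightarrow> rec_eval r xs (f xs)"
    using assms unfolding total_rec_def by blast
  show ?thesis unfolding total_rec_def
    by (rule exI[of _ "Comp Succ [r]"])
      (use r in \<open>auto simp: rec_eval_Comp_iff rec_eval_Succ_iff list_all2_Cons1\<close>)
qed

lemma total_rec_const: "total_rec n (\<lambda>_. k)"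
proof (induction k)
  case 0
  show ?case unfolding total_rec_def by (rule exI[of _ Zero]) (simp add: rec_eval_Zero_iff)
qed (rule total_rec_Suc)

lemma total_rec_comp1:
  assumes "total_rec 1 (\<lambda>xs. g (xs ! 0))" "total_rec n f"
  shows "total_rec n (\<lambda>xs. g (f xs))"
proof -
  obtain q r where q: "\<forall>xs. length xs = 1 \<longrightarrow> rec_eval q xs (g (xs ! 0))"
    and r: "\<forall>xs. length xs = n \<longrightarrow> rec_eval r xs (f xs)"
    using assms unfolding total_rec_def by blast
  have "rec_eval (Comp q [r]) xs (g (f xs))" if "length xs = n" for xs
    using r[rule_format, OF that] q[rule_format, of "[f xs]"] by (intro rec_eval.comp[of _ _ "[f xs]"]) auto
  then show ?thesis unfolding total_rec_def by blast
qed

lemma total_rec_comp2: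
  assumes "total_rec 2 (\<lambda>xs. g (xs ! 0) (xs ! 1))" "total_rec n f" "total_rec n f'"
  shows "total_rec n (\<lambda>xs. g (f xs) (f' xs))"
proof -
  obtain q r r' where q: "\<forall>xs. length xs = 2 \<longrightarrow> rec_eval q xs (g (xs ! 0) (xs ! 1))"
    and r: "\<forall>xs. length xs = n \<longrightarrow> rec_eval r xs (f xs)"
    and r': "\<forall>xs. length xs = n \<longrightarrow> rec_eval r' xs (f' xs)"
    using assms unfolding total_rec_def by blast
  have "rec_eval (Comp q [r, r']) xs (g (f xs) (f' xs))" if "length xs = n" for xs
    using r[rule_format, OF that] r'[rule_format, OF that] q[rule_format, of "[f xs, f' xs]"]
    by (intro rec_eval.comp[of _ _ "[f xs, f' xs]"]) auto
  then show ?thesis unfolding total_rec_def by blast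
qed

lemma total_rec_rec:
  assumes "total_rec n f" "total_rec (Suc (Suc n)) g"
    and "\<And>xs. length xs = n \<Longrightarrow> h (0 # xs) = f xs"
    and "\<And>k xs. length xs = n \<Longrightarrow> h (Suc k # xs) = g (k # h (k # xs) # xs)"
  shows "total_rec (Suc n) h"
proof -
  obtain q r where q: "\<forall>xs. length xs = n \<longrightarrow> rec_eval q xs (f xs)"
    and r: "\<forall>xs. length xs = Suc (Suc n) \<longrightarrow> rec_eval r xs (g xs)"
    using assms(1,2) unfolding total_rec_def by blast
  have "rec_eval (PrimRec q r) (k # xs) (h (k # xs))" if "length xs = n" for k xs
  proof (induction k)
    case 0
    show ?case using q that by (simp add: assms(3)[OF that] rec_eval.prim_0)
  next
    case (Suc k)
    show ?case unfolding assms(4)[OF that]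
      by (rule rec_eval.prim_Suc, rule Suc.IH) (use r that in simp)
  qed
  then show ?thesis unfolding total_rec_def
    by (intro exI[of _ "PrimRec q r"]) (auto simp: length_Suc_conv)
qed

lemma total_rec_add:
  assumes "total_rec n f" "total_rec n g"
  shows "total_rec n (\<lambda>xs. f xs + g xs)"
proof -
  have "total_rec (Suc 1) (\<lambda>xs. xs ! 0 + xs ! 1)"
    by (rule total_rec_rec[where f = "\<lambda>xs. xs ! 0" and g = "\<lambda>xs. Suc (xs ! 1)"])
      (auto intro!: total_rec_proj total_rec_Suc)
  then show ?thesis using total_rec_comp2[of "(+)"] assms by (simp add: numeral_2_eq_2)
qed

lemma total_rec_pow2:
  assumes "total_rec n f"
  shows "total_rec n (\<lambda>xs. 2 ^ f xs)"
proof -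
  have "total_rec (Suc 0) (\<lambda>xs. 2 ^ (xs ! 0))"
    by (rule total_rec_rec[where f = "\<lambda>xs. 1" and g = "\<lambda>xs. xs ! 1 + xs ! 1"])
      (auto intro!: total_rec_proj total_rec_const total_rec_add)
  then show ?thesis using total_rec_comp1[of "(^) 2"] assms by simp
qed

lemma total_rec_pred:
  assumes "total_rec n f"
  shows "total_rec n (\<lambda>xs. f xs - 1)"
proof -
  have "total_rec (Suc 0) (\<lambda>xs. xs ! 0 - 1)"
    by (rule total_rec_rec[where f = "\<lambda>xs. 0" and g = "\<lambda>xs. xs ! 0"])
      (auto intro!: total_rec_proj total_rec_const)
  then show ?thesis using total_rec_comp1[of "\<lambda>k. k - 1"] assms by simp
qed

lemma total_rec_prod_encode:
  assumes "total_rec n f" "total_rec n g"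
  shows "total_rec n (\<lambda>xs. prod_encode (f xs, g xs))"
proof -
  have "total_rec (Suc 0) (\<lambda>xs. triangle (xs ! 0))"
    by (rule total_rec_rec[where f = "\<lambda>xs. 0" and g = "\<lambda>xs. xs ! 1 + Suc (xs ! 0)"])
      (auto intro!: total_rec_proj total_rec_const total_rec_add total_rec_Suc)
  then have "total_rec n (\<lambda>xs. triangle (f xs + g xs) + f xs)"
    using total_rec_comp1[of triangle] assms by (auto intro!: total_rec_add)
  then show ?thesis by (simp add: prod_encode_def)
qed

lemma total_rec_list_encode:
  assumes "\<And>f. f \<in> set fs \<Longrightarrow> total_rec n f"
  shows "total_rec n (\<lambda>xs. list_encode (map (\<lambda>f. f xs) fs))"
  using assms
  by (induction fs) (auto intro!: total_rec_const total_rec_Suc total_rec_prod_encode)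

section \<open>The automata\<close>

text \<open>\<open>Ctl\<close> runs a finite automaton for the program; \<open>Tr i j\<close> follows the contents of two registers
  through the copy operations (guessing which copies will matter), with \<open>4\<^sup>n\<close> divided by the discount
  product equal to 2 to the difference of their contents; the \<open>Err\<close> states are entered at a
  guard that is claimed to fail; \<open>Ref\<close> is the reference run. The letter \<open>None\<close> ends the computation,
  and only its first occurrence carries weight.\<close>

datatype st = Ctl nat | Tr nat nat | Err | ErrLo | ErrHi | Ref | Sink

instance st :: countable by countable_datatype

fun src :: "op \<Rightarrow> nat \<Rightarrow> nat" where
  "src (Copy k l) i = (if i = k then l else i)"
| "src _ i = i"

fun gain :: "op \<Rightarrow> nat \<Rightarrow> nat" where
  "gain (Inc k) i = (if i = k then 1 else 0)"
| "gain _ i = 0"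

text \<open>Reads an operation backwards: the new content of \<open>i\<close> comes from a single
  old register. A forward run must guess which register that is for, because one register may be
  copied to several.\<close>

lemma upd_apply: "upd a \<sigma> i = \<sigma> (src a i) + gain a i"
  by (cases a) auto

lemma gain_le: "gain a i \<le> 1"
  by (cases a) auto

text \<open>The rule \<open>Sink\<close> makes the automaton complete. A run that enters
  \<open>Sink\<close> before the end letter gets value 0 and refutes nothing; since no other rule
  reads \<open>None\<close>, every run is in \<open>Sink\<close> after the first end letter.\<close>

inductive step :: "(nat \<Rightarrow> op \<Rightarrow> nat) \<Rightarrow> st \<Rightarrow> op option \<Rightarrow> st \<Rightarrow> bool" for \<delta> where
  Sink: "step \<delta> q b Sink"
| Ctl: "step \<delta> (Ctl c) (Some a) (Ctl (\<delta> c a))"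
| Ref: "step \<delta> Ref (Some a) Ref"
| Err: "step \<delta> Err (Some a) Err"
| ErrLo: "step \<delta> ErrLo (Some a) ErrLo"
| ErrHi: "step \<delta> ErrHi (Some a) ErrHi"
| Tr: "step \<delta> (Tr (src a i) (src a j)) (Some a) (Tr i j)"
| fail_Leq: "step \<delta> (Tr k l) (Some (Leq k l)) Err"
| fail_InLe: "step \<delta> (Tr 0 1) (Some InLe) ErrLo"
| fail_InGe: "step \<delta> (Tr 1 0) (Some InGe) ErrHi"

text \<open>Let \<open>R\<close> be 2 to the difference of the tracked contents. If
  \<open>Leq\<close> fails, \<open>R \<ge> 2\<close>; if \<open>InLe\<close> fails,
  \<open>R \<ge> 2 * 2 ^ x\<close>; if \<open>InGe\<close> fails, with the registers tracked in the
  opposite order, \<open>R * 2 ^ x \<ge> 2\<close>. In each case the weight times \<open>R\<close>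
  is at most -2, and it is at least -1 if the guard holds.\<close>

fun outw :: "nat set \<Rightarrow> nat \<Rightarrow> st \<Rightarrow> rat" where
  "outw F x (Ctl c) = (if c \<in> F then 0 else -2)"
| "outw F x (Tr i j) = 0"
| "outw F x Err = -1"
| "outw F x ErrLo = - 1 / 2 ^ x"
| "outw F x ErrHi = - (2 ^ x)"
| "outw F x Ref = -2"
| "outw F x Sink = 0"

text \<open>Chosen so that 4 divided by the factor is 2 to the change of the difference. As gains
  are 0 or 1, the factor is 2, 4 or 8 and hence an integer above 1.\<close>

fun disc :: "st \<Rightarrow> op option \<Rightarrow> st \<Rightarrow> rat" where
  "disc (Tr _ _) (Some a) (Tr i j) = 4 * 2 ^ gain a j / 2 ^ gain a i"
| "disc _ _ _ = 4"

definition letters :: "nat \<Rightarrow> op option set" where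
  "letters N = insert None (Some ` {a. regs a \<subseteq> {..<N}})"

definition locs :: "nat \<Rightarrow> nat \<Rightarrow> st set" where
  "locs M N = Ctl ` {..<M} \<union> (\<lambda>(i, j). Tr i j) ` ({..<N} \<times> {..<N}) \<union> {Err, ErrLo, ErrHi, Ref, Sink}"

definition arcs :: "(nat \<Rightarrow> op \<Rightarrow> nat) \<Rightarrow> nat \<Rightarrow> nat \<Rightarrow> (st \<times> op option \<times> st) set" where
  "arcs \<delta> M N = {(p, b, q). p \<in> locs M N \<and> b \<in> letters N \<and> q \<in> locs M N \<and> step \<delta> p b q}"

definition enc_arc :: "st \<times> op option \<times> st \<Rightarrow> nat \<times> nat \<times> nat" where
  "enc_arc = (\<lambda>(p, b, q). (to_nat p, to_nat b, to_nat q))"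

definition aut :: "(nat \<Rightarrow> op \<Rightarrow> nat) \<Rightarrow> nat set \<Rightarrow> nat \<Rightarrow> nat \<Rightarrow> nat \<Rightarrow> st set \<Rightarrow> (nat, nat) nmda" where
  "aut \<delta> F M N x I = \<lparr>alphabet = to_nat ` letters N, states = to_nat ` locs M N, initial = to_nat ` I,
     transitions = enc_arc ` arcs \<delta> M N,
     weight = (\<lambda>(p, b, q). if from_nat b = (None :: op option) then outw F x (from_nat p) else 0),
     discount = (\<lambda>(p, b, q). disc (from_nat p) (from_nat b) (from_nat q))\<rparr>"

section \<open>Finiteness and well-formedness of the automata\<close>

lemma finite_letters: "finite (letters N)"
proof -
  have "{a. regs a \<subseteq> {..<N}} \<subseteq> (\<lambda>(k, l). Copy k l) ` ({..<N} \<times> {..<N}) \<union> Inc ` {..<N}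
    \<union> (\<lambda>(k, l). Leq k l) ` ({..<N} \<times> {..<N}) \<union> {InLe, InGe}"
  proof
    fix a assume "a \<in> {a. regs a \<subseteq> {..<N}}"
    then show "a \<in> (\<lambda>(k, l). Copy k l) ` ({..<N} \<times> {..<N}) \<union> Inc ` {..<N}
      \<union> (\<lambda>(k, l). Leq k l) ` ({..<N} \<times> {..<N}) \<union> {InLe, InGe}"
      by (cases a) auto
  qed
  then show ?thesis unfolding letters_def by (auto intro: finite_subset)
qed

lemma finite_locs: "finite (locs M N)"
  unfolding locs_def by simp

lemma disc_cases: "disc p b q \<in> {2, 4, 8}"
proof (cases "(p, b, q)" rule: disc.cases)
  case (1 k l a i j)
  have "gain a i = 0 \<or> gain a i = 1" "gain a j = 0 \<or> gain a j = 1"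
    using gain_le[of a i] gain_le[of a j] by auto
  then show ?thesis using 1 by auto
qed auto

lemma aut_wf:
  assumes "I \<subseteq> locs M N"
  shows "is_nmda (aut \<delta> F M N x I)" "integral_nmda (aut \<delta> F M N x I)"
proof -
  have "1 < disc p b q" "disc p b q \<in> \<int>" for p b q
    using disc_cases[of p b q] by auto
  moreover have "\<exists>q. (p, b, q) \<in> enc_arc ` arcs \<delta> M N"
    if "p \<in> to_nat ` locs M N" "b \<in> to_nat ` letters N" for p b
  proof -
    from that obtain p' b' where "p = to_nat p'" "p' \<in> locs M N" "b = to_nat b'" "b' \<in> letters N" by blast
    then have "enc_arc (p', b', Sink) = (p, b, to_nat Sink)" "(p', b', Sink) \<in> arcs \<delta> M N"
      by (auto simp: enc_arc_def arcs_def locs_def intro: step.Sink)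
    then show ?thesis by (metis image_eqI)
  qed
  moreover have "letters N \<noteq> {}" by (simp add: letters_def)
  moreover have "enc_arc ` arcs \<delta> M N \<subseteq> to_nat ` locs M N \<times> to_nat ` letters N \<times> to_nat ` locs M N"
    by (auto simp: enc_arc_def arcs_def)
  ultimately show "is_nmda (aut \<delta> F M N x I)" "integral_nmda (aut \<delta> F M N x I)"
    using assms finite_letters finite_locs
    by (auto simp: is_nmda_def integral_nmda_def aut_def)
qed


section \<open>Values of runs and words\<close>

text \<open>Finite and infinite words are treated together as functions on a set of positions
  \<open>D\<close>, which is \<open>{..<n}\<close> or \<open>UNIV\<close>.\<close>

definition dprod :: "(nat \<Rightarrow> st) \<Rightarrow> (nat \<Rightarrow> op option) \<Rightarrow> nat \<Rightarrow> real" where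
  "dprod p w h = (\<Prod>j<h. 1 / real_of_rat (disc (p j) (w j) (p (Suc j))))"

definition paths :: "(nat \<Rightarrow> op \<Rightarrow> nat) \<Rightarrow> nat \<Rightarrow> nat \<Rightarrow> st set \<Rightarrow> nat set \<Rightarrow> (nat \<Rightarrow> op option) \<Rightarrow> (nat \<Rightarrow> st) set" where
  "paths \<delta> M N I D w = {p. p 0 \<in> I \<and> (\<forall>i\<in>D. (p i, w i, p (Suc i)) \<in> arcs \<delta> M N)}"

text \<open>The whole discounted sum collapses to its term at the first end letter. Without an end
  letter all weights vanish, hence the default 0.\<close>

definition pval :: "nat set \<Rightarrow> nat \<Rightarrow> nat set \<Rightarrow> (nat \<Rightarrow> op option) \<Rightarrow> (nat \<Rightarrow> st) \<Rightarrow> real" where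
  "pval F x D w p = (if \<exists>h\<in>D. w h = None
     then let h = LEAST h. w h = None in real_of_rat (outw F x (p h)) * dprod p w h else 0)"

lemma dprod_0 [simp]: "dprod p w 0 = 1"
  by (simp add: dprod_def)

lemma dprod_Suc [simp]:
  "dprod p w (Suc h) = dprod p w h / real_of_rat (disc (p h) (w h) (p (Suc h)))"
  by (simp add: dprod_def)

lemma step_to_Sink: "step \<delta> p b q \<Longrightarrow> b = None \<or> p = Sink \<Longrightarrow> q = Sink"
  by (cases rule: step.cases) auto

lemma discounted_weight_aut:
  "discounted_weight (aut \<delta> F M N x I) (trans_at P W) i =
   (if from_nat (W i) = (None :: op option)
    then real_of_rat (outw F x (from_nat (P i))) * dprod (from_nat \<circ> P) (from_nat \<circ> W) i else 0)"
  by (simp add: discounted_weight_def aut_def trans_at_def dprod_def)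

text \<open>After the first end letter the run stays in \<open>Sink\<close>, whose weight is 0, so
  later end letters add nothing.\<close>

lemma discounted_weight_pval:
  assumes p: "p \<in> paths \<delta> M N I D w" and D: "\<And>i j. i \<in> D \<Longrightarrow> j \<le> i \<Longrightarrow> j \<in> D" and i: "i \<in> D"
  shows "(if w i = None then real_of_rat (outw F x (p i)) * dprod p w i else 0) =
    (if w i = None \<and> i = (LEAST h. w h = None) then pval F x D w p else 0)"
proof (cases "w i = None")
  case True
  let ?h = "LEAST h. w h = None"
  have h: "w ?h = None" "?h \<le> i" using True by (rule LeastI, rule Least_le)
  have "j \<le> i \<Longrightarrow> ?h < j \<Longrightarrow> p j = Sink" for j
  proof (induction j)
    case (Suc j)
    have "step \<delta> (p j) (w j) (p (Suc j))"
      using p D[OF i, of j] Suc.prems by (auto simp: paths_def arcs_def)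
    moreover have "w j = None \<or> p j = Sink"
      using Suc h(1) by (cases "j = ?h") auto
    ultimately show ?case by (rule step_to_Sink)
  qed simp
  then have "?h < i \<Longrightarrow> p i = Sink" by simp
  moreover have "\<exists>h\<in>D. w h = None" using True i by blast
  ultimately show ?thesis using True h(2) by (auto simp: pval_def Let_def)
qed (simp only: if_False simp_thms)

lemma from_nat_arcs:
  "(P, W, P') \<in> enc_arc ` arcs \<delta> M N \<Longrightarrow> (from_nat P, from_nat W, from_nat P') \<in> arcs \<delta> M N"
  by (auto simp: enc_arc_def)

lemma to_nat_arcs:
  "(p, w, p') \<in> arcs \<delta> M N \<Longrightarrow> (to_nat p, to_nat w, to_nat p') \<in> enc_arc ` arcs \<delta> M N"
  by (force simp: enc_arc_def)

text \<open>A finite run is a list while a path is a function on all positions; \<open>P\<close> is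
  any function that agrees with the list on its positions.\<close>

lemma finite_run_value_aut:
  assumes "from_nat \<circ> P \<in> paths \<delta> M N I {..<length W} (from_nat \<circ> (!) W)" "\<And>i. i \<le> length W \<Longrightarrow> P i = Ps ! i"
  shows "finite_run_value (aut \<delta> F M N x I) W Ps =
    pval F x {..<length W} (from_nat \<circ> (!) W) (from_nat \<circ> P)"
proof -
  let ?w = "from_nat \<circ> (!) W :: nat \<Rightarrow> op option" and ?p = "from_nat \<circ> P"
  have dw: "discounted_weight (aut \<delta> F M N x I) (trans_at P ((!) W)) i =
    (if ?w i = None \<and> i = (LEAST h. ?w h = None) then pval F x {..<length W} ?w ?p else 0)"
    if "i < length W" for i
    unfolding discounted_weight_aut
    using discounted_weight_pval[OF assms(1), of i F x] that by auto
  have "finite_run_value (aut \<delta> F M N x I) W Ps =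
    (\<Sum>i<length W. discounted_weight (aut \<delta> F M N x I) (trans_at P ((!) W)) i)"
    unfolding finite_run_value_def discounted_weight_def trans_at_def
    by (intro sum.cong refl arg_cong2[of _ _ _ _ "(*)"] prod.cong) (auto simp: assms(2))
  also have "\<dots> = (\<Sum>i<length W. if ?w i = None \<and> i = (LEAST h. ?w h = None)
      then pval F x {..<length W} ?w ?p else 0)"
    by (intro sum.cong refl dw) simp
  also have "\<dots> = pval F x {..<length W} ?w ?p"
  proof (cases "\<exists>h<length W. ?w h = None")
    case True
    then obtain h where h: "h < length W" "?w h = None" by blast
    have L: "?w (LEAST h. ?w h = None) = None" "(LEAST h. ?w h = None) \<le> h"
      using h(2) by (rule LeastI, rule Least_le)
    have "(\<Sum>i<length W. if ?w i = None \<and> i = (LEAST h. ?w h = None)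
      then pval F x {..<length W} ?w ?p else 0) =
      (\<Sum>i<length W. if i = (LEAST h. ?w h = None) then pval F x {..<length W} ?w ?p else 0)"
      using L(1) by (intro sum.cong) auto
    then show ?thesis using L(2) h(1) by (simp add: sum.delta)
  next
    case False
    then show ?thesis by (auto simp: pval_def intro!: sum.neutral)
  qed
  finally show ?thesis .
qed

lemma infinite_run_value_aut:
  assumes "from_nat \<circ> P \<in> paths \<delta> M N I UNIV (from_nat \<circ> W)"
  shows "infinite_run_value (aut \<delta> F M N x I) W P = pval F x UNIV (from_nat \<circ> W) (from_nat \<circ> P)"
proof -
  let ?w = "from_nat \<circ> W :: nat \<Rightarrow> op option" and ?p = "from_nat \<circ> P"
  have eq: "discounted_weight (aut \<delta> F M N x I) (trans_at P W) i =
    (if ?w i = None \<and> i = (LEAST h. ?w h = None) then pval F x UNIV ?w ?p else 0)" for i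
    unfolding discounted_weight_aut
    using discounted_weight_pval[OF assms, of i F x] by auto
  show ?thesis
  proof (cases "\<exists>h. ?w h = None")
    case True
    then have "?w (LEAST h. ?w h = None) = None" by (rule LeastI_ex)
    then have "discounted_weight (aut \<delta> F M N x I) (trans_at P W) =
      (\<lambda>i. if i = (LEAST h. ?w h = None) then pval F x UNIV ?w ?p else 0)"
      by (intro ext) (auto simp: eq)
    then show ?thesis unfolding infinite_run_value_def
      using sums_single[of "LEAST h. ?w h = None" "\<lambda>_. pval F x UNIV ?w ?p"] by (simp add: sums_iff)
  next
    case False
    have n: "?w h \<noteq> None" for h by (rule notI) (use False in \<open>rule notE[OF _ exI]\<close>)
    then have "discounted_weight (aut \<delta> F M N x I) (trans_at P W) = (\<lambda>_. 0)"
      by (intro ext) (simp only: eq simp_thms if_False)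
    moreover have "pval F x UNIV ?w ?p = 0" unfolding pval_def using False by (simp only: bex_UNIV if_False)
    ultimately show ?thesis unfolding infinite_run_value_def by simp
  qed
qed

lemma finite_word_value_aut:
  "finite_word_value (aut \<delta> F M N x I) W =
    (INF p\<in>paths \<delta> M N I {..<length W} (from_nat \<circ> (!) W).
      ereal (pval F x {..<length W} (from_nat \<circ> (!) W) p))"
  if "set W \<subseteq> to_nat ` letters N"
proof -
  let ?A = "aut \<delta> F M N x I" and ?D = "{..<length W}"
  let ?w = "from_nat \<circ> (!) W :: nat \<Rightarrow> op option"
  \<comment> \<open>Decoding followed by encoding is the identity on codes of letters, which is
    where the hypothesis on \<open>W\<close> enters.\<close>
  have w: "to_nat (?w i) = W ! i" if "i < length W" for i
  proof -
    from that have "W ! i \<in> to_nat ` letters N" using \<open>set W \<subseteq> _\<close> nth_mem by blast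
    then show ?thesis by auto
  qed
  have "(\<lambda>p. finite_run_value ?A W p) ` finite_runs ?A W = pval F x ?D ?w ` paths \<delta> M N I ?D ?w"
  proof (intro equalityI image_subsetI)
    fix P assume P: "P \<in> finite_runs ?A W"
    then have "from_nat \<circ> (!) P \<in> paths \<delta> M N I ?D ?w"
      by (auto simp: finite_runs_def paths_def aut_def trans_at_def intro!: from_nat_arcs)
    then show "finite_run_value ?A W P \<in> pval F x ?D ?w ` paths \<delta> M N I ?D ?w"
      using finite_run_value_aut[of "(!) P"] by blast
  next
    fix p assume p: "p \<in> paths \<delta> M N I ?D ?w"
    let ?P = "map (to_nat \<circ> p) [0..<Suc (length W)]"
    have nth: "?P ! i = to_nat (p i)" if "i \<le> length W" for i
      using that by (simp del: upt_Suc)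
    have "?P \<in> finite_runs ?A W"
      unfolding finite_runs_def mem_Collect_eq trans_at_def
    proof (intro conjI allI impI)
      show "?P ! 0 \<in> initial ?A" using p nth[of 0] by (simp add: paths_def aut_def del: upt_Suc)
      fix i assume i: "i < length W"
      have "(p i, ?w i, p (Suc i)) \<in> arcs \<delta> M N" using p i by (simp add: paths_def)
      from to_nat_arcs[OF this] show "(?P ! i, W ! i, ?P ! Suc i) \<in> transitions ?A"
        using i nth[of i] nth[of "Suc i"] w[OF i] by (simp add: aut_def del: upt_Suc)
    qed simp
    moreover have "finite_run_value ?A W ?P = pval F x ?D ?w p"
      using finite_run_value_aut[of "to_nat \<circ> p" \<delta> M N I W ?P F x] p nth
      by (simp add: comp_def del: upt_Suc)
    ultimately show "pval F x ?D ?w p \<in> finite_run_value ?A W ` finite_runs ?A W" by (metis image_eqI)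
  qed
  then have "ereal ` finite_run_value ?A W ` finite_runs ?A W = ereal ` pval F x ?D ?w ` paths \<delta> M N I ?D ?w"
    by simp
  then show ?thesis unfolding finite_word_value_def image_image by simp
qed

lemma infinite_word_value_aut:
  "infinite_word_value (aut \<delta> F M N x I) W =
    (INF p\<in>paths \<delta> M N I UNIV (from_nat \<circ> W). ereal (pval F x UNIV (from_nat \<circ> W) p))"
  if "\<And>i. W i \<in> to_nat ` letters N"
proof -
  let ?A = "aut \<delta> F M N x I"
  let ?w = "from_nat \<circ> W :: nat \<Rightarrow> op option"
  have w: "to_nat (?w i) = W i" for i using that[of i] by auto
  have "(\<lambda>p. infinite_run_value ?A W p) ` infinite_runs ?A W = pval F x UNIV ?w ` paths \<delta> M N I UNIV ?w"
  proof (intro equalityI image_subsetI)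
    fix P assume P: "P \<in> infinite_runs ?A W"
    then have "from_nat \<circ> P \<in> paths \<delta> M N I UNIV ?w"
      by (auto simp: infinite_runs_def paths_def aut_def trans_at_def intro!: from_nat_arcs)
    then show "infinite_run_value ?A W P \<in> pval F x UNIV ?w ` paths \<delta> M N I UNIV ?w"
      using infinite_run_value_aut[of P] by blast
  next
    fix p assume p: "p \<in> paths \<delta> M N I UNIV ?w"
    have "to_nat \<circ> p \<in> infinite_runs ?A W"
      unfolding infinite_runs_def mem_Collect_eq trans_at_def
    proof (intro conjI allI)
      show "(to_nat \<circ> p) 0 \<in> initial ?A" using p by (simp add: paths_def aut_def)
      fix i
      have "(p i, ?w i, p (Suc i)) \<in> arcs \<delta> M N" using p by (simp add: paths_def)
      from to_nat_arcs[OF this] show "((to_nat \<circ> p) i, W i, (to_nat \<circ> p) (Suc i)) \<in> transitions ?A"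
        using w[of i] by (simp add: aut_def)
    qed
    moreover have "infinite_run_value ?A W (to_nat \<circ> p) = pval F x UNIV ?w p"
      using infinite_run_value_aut[of "to_nat \<circ> p" \<delta> M N I W F x] p by (simp add: comp_def)
    ultimately show "pval F x UNIV ?w p \<in> infinite_run_value ?A W ` infinite_runs ?A W"
      by (metis image_eqI)
  qed
  then have "ereal ` infinite_run_value ?A W ` infinite_runs ?A W = ereal ` pval F x UNIV ?w ` paths \<delta> M N I UNIV ?w"
    by simp
  then show ?thesis unfolding infinite_word_value_def image_image by simp
qed

section \<open>Bounds on the values of challenging runs\<close>

text \<open>All registers are 0 at the start, so every pair has difference 0 and the empty discount
  product is right for each of them.\<close>

definition starts :: "nat \<Rightarrow> nat \<Rightarrow> st set" where
  "starts q0 N = insert (Ctl q0) ((\<lambda>(i, j). Tr i j) ` ({..<N} \<times> {..<N}))"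

locale program_dfa =
  fixes \<delta> :: "nat \<Rightarrow> op \<Rightarrow> nat" and q0 :: nat and F :: "nat set" and M N :: nat and L :: "op list set"
  assumes q0: "q0 < M"
    and \<delta>: "q < M \<Longrightarrow> \<delta> q a < M"
    and acc: "w \<in> L \<longleftrightarrow> foldl \<delta> q0 w \<in> F"
    and regs: "w \<in> L \<Longrightarrow> a \<in> set w \<Longrightarrow> regs a \<subseteq> {..<N}"
begin

abbreviation init :: "st set" where
  "init \<equiv> starts q0 N"

text \<open>Here \<open>R\<close> is \<open>4\<^sup>n\<close> divided by the discount product of the run, where \<open>n\<close> is the length of \<open>u\<close>.\<close>

fun run_inv :: "nat \<Rightarrow> op list \<Rightarrow> real \<Rightarrow> st \<Rightarrow> bool" where
  "run_inv x u R (Ctl c) \<longleftrightarrow> c = foldl \<delta> q0 u"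
| "run_inv x u R (Tr i j) \<longleftrightarrow> R * 2 ^ fold upd u (\<lambda>_. 0) j = 2 ^ fold upd u (\<lambda>_. 0) i"
| "run_inv x u R Err \<longleftrightarrow> R \<le> 1"
| "run_inv x u R ErrLo \<longleftrightarrow> R \<le> 2 ^ x"
| "run_inv x u R ErrHi \<longleftrightarrow> R * 2 ^ x \<le> 1"
| "run_inv x u R Ref \<longleftrightarrow> False"
| "run_inv x u R Sink \<longleftrightarrow> True"

text \<open>Contents are natural numbers whose difference may be negative, so the ratio is described
  by an equation between powers instead of a power of a difference.\<close>

lemma Tr_ratio_le:
  assumes "R * 2 ^ a = (2::real) ^ b" "b + c \<le> a + d"
  shows "R * 2 ^ c \<le> 2 ^ d"
proof -
  have "R * 2 ^ c * 2 ^ a = (2::real) ^ (b + c)" using assms(1) by (simp add: power_add mult_ac)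
  also have "\<dots> \<le> 2 ^ (a + d)" using assms(2) by (intro power_increasing) auto
  finally show ?thesis by (simp add: power_add)
qed

lemma Tr_ratio_ge:
  assumes "R * 2 ^ a = (2::real) ^ b" "a + d \<le> b + c"
  shows "2 ^ d \<le> R * 2 ^ c"
proof -
  have "(2::real) ^ (a + d) \<le> 2 ^ (b + c)" using assms(2) by (intro power_increasing) auto
  also have "\<dots> = R * 2 ^ c * 2 ^ a" using assms(1) by (simp add: power_add mult_ac)
  finally show ?thesis by (simp add: power_add)
qed

lemma Tr_ratio_step:
  assumes "R * 2 ^ \<sigma> (src a j) = (2::real) ^ \<sigma> (src a i)"
  shows "R * 4 / real_of_rat (disc (Tr k l) (Some a) (Tr i j)) * 2 ^ upd a \<sigma> j = 2 ^ upd a \<sigma> i"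
  using assms by (simp add: upd_apply of_rat_divide of_rat_mult of_rat_power power_add field_simps)

text \<open>The guard matters at an unjustified challenge: its truth bounds the ratio that is handed
  to the error state. Error states themselves divide by 4 and leave the ratio unchanged.\<close>

lemma run_inv_step:
  assumes "run_inv x u R q" "step \<delta> q (Some a) q'" "guard x a (fold upd u (\<lambda>_. 0))"
  shows "run_inv x (u @ [a]) (R * 4 / real_of_rat (disc q (Some a) q')) q'"
  using assms(2)
proof cases
  case (Tr i j)
  then show ?thesis using assms(1) Tr_ratio_step by simp
next
  case (fail_Leq k l)
  then show ?thesis using assms Tr_ratio_le[of R _ _ 0 0] by simp
next
  case fail_InLe
  then show ?thesis using assms Tr_ratio_le[of R _ _ 0 x] by simp
next
  case fail_InGe
  then show ?thesis using assms Tr_ratio_le[of R _ _ x 0] by simp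
qed (use assms(1) in auto)

lemma valid_nth:
  "valid x u \<sigma> \<longleftrightarrow> (\<forall>i<length u. guard x (u ! i) (fold upd (take i u) \<sigma>))"
  by (induction u arbitrary: \<sigma>) (auto simp: less_Suc_eq_0_disj)

lemma run_lower:
  assumes "p 0 \<in> init" "\<And>i. i < length u \<Longrightarrow> step \<delta> (p i) (w i) (p (Suc i))"
    and w: "\<And>i. i < length u \<Longrightarrow> w i = Some (u ! i)"
    and "valid x u (\<lambda>_. 0)" "u \<in> L"
  shows "- 1 / 4 ^ length u \<le> real_of_rat (outw F x (p (length u))) * dprod p w (length u)"
proof -
  have "i \<le> length u \<Longrightarrow> run_inv x (take i u) (dprod p w i * 4 ^ i) (p i)" for i
  proof (induction i)
    case 0
    show ?case using assms(1) by (auto simp: starts_def)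
  next
    case (Suc i)
    then have i: "i < length u" by simp
    have "run_inv x (take i u @ [u ! i]) (dprod p w i * 4 ^ i * 4 /
      real_of_rat (disc (p i) (Some (u ! i)) (p (Suc i)))) (p (Suc i))"
      by (rule run_inv_step) (use Suc assms(2)[OF i] w[OF i] assms(4) i in \<open>auto simp: valid_nth\<close>)
    then show ?case using i w[OF i] by (simp add: take_Suc_conv_app_nth mult_ac)
  qed
  from this[of "length u"] have I: "run_inv x u (dprod p w (length u) * 4 ^ length u) (p (length u))" by simp
  \<comment> \<open>\<open>Ctl\<close> contributes 0 because it ends in \<open>F\<close>; for the
    error states the bound of the invariant cancels against the power of 2 in the weight.\<close>
  have "- 1 \<le> real_of_rat (outw F x (p (length u))) * (dprod p w (length u) * 4 ^ length u)"
    using I acc[of u] assms(5)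
    by (cases "p (length u)") (auto simp: of_rat_divide of_rat_power of_rat_minus field_simps)
  then show ?thesis by (simp add: field_simps)
qed

lemma run_Ref:
  assumes "p 0 = Ref" "\<And>i. i < h \<Longrightarrow> step \<delta> (p i) (w i) (p (Suc i))"
  shows "- 2 / 4 ^ h \<le> real_of_rat (outw F x (p h)) * dprod p w h"
proof -
  have "i \<le> h \<Longrightarrow> (p i = Ref \<or> p i = Sink) \<and> dprod p w i = 1 / 4 ^ i" for i
  proof (induction i)
    case (Suc i)
    then have "step \<delta> (p i) (w i) (p (Suc i))" "p i = Ref \<or> p i = Sink" "dprod p w i = 1 / 4 ^ i"
      using assms(2) by auto
    then show ?case by (auto elim: step.cases)
  qed (use assms in auto)
  from this[of h] show ?thesis by auto
qed

text \<open>The right guesses are found from the end of the word: a run that ends in the pair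
  \<open>(k, l)\<close> after \<open>a\<close> extends one that ends in the pair of their sources
  before \<open>a\<close>.\<close>

lemma track:
  assumes "\<And>a. a \<in> set u \<Longrightarrow> regs a \<subseteq> {..<N}" "k < N" "l < N"
  shows "\<exists>p. p 0 \<in> init \<and> p (length u) = Tr k l \<and> (\<forall>i\<le>length u. p i \<in> locs M N) \<and>
    (\<forall>i<length u. step \<delta> (p i) (Some (u ! i)) (p (Suc i))) \<and>
    dprod p (\<lambda>i. Some (u ! i)) (length u) * 4 ^ length u * 2 ^ fold upd u (\<lambda>_. 0) l = 2 ^ fold upd u (\<lambda>_. 0) k"
  using assms
proof (induction u arbitrary: k l rule: rev_induct)
  case Nil
  then show ?case by (intro exI[of _ "\<lambda>_. Tr k l"]) (auto simp: starts_def locs_def)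
next
  case (snoc a u)
  have "src a i < N" if "i < N" for i
    using snoc.prems(1)[of a] that by (cases a) auto
  with snoc.prems have "src a k < N" "src a l < N" by auto
  from snoc.IH[OF _ this] snoc.prems(1) obtain p where p: "p 0 \<in> init"
    "p (length u) = Tr (src a k) (src a l)" "\<forall>i\<le>length u. p i \<in> locs M N"
    "\<forall>i<length u. step \<delta> (p i) (Some (u ! i)) (p (Suc i))"
    "dprod p (\<lambda>i. Some (u ! i)) (length u) * 4 ^ length u * 2 ^ fold upd u (\<lambda>_. 0) (src a l)
      = 2 ^ fold upd u (\<lambda>_. 0) (src a k)" by auto
  define p' where "p' = p(Suc (length u) := Tr k l)"
  have "dprod p' (\<lambda>i. Some ((u @ [a]) ! i)) (length u) = dprod p (\<lambda>i. Some (u ! i)) (length u)"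
    unfolding dprod_def by (intro prod.cong) (auto simp: nth_append p'_def)
  then have "dprod p' (\<lambda>i. Some ((u @ [a]) ! i)) (length (u @ [a])) * 4 ^ length (u @ [a]) =
    dprod p (\<lambda>i. Some (u ! i)) (length u) * 4 ^ length u * 4 /
      real_of_rat (disc (Tr (src a k) (src a l)) (Some a) (Tr k l))"
    using p(2) by (simp add: p'_def del: disc.simps)
  then have "dprod p' (\<lambda>i. Some ((u @ [a]) ! i)) (length (u @ [a])) * 4 ^ length (u @ [a]) *
    2 ^ fold upd (u @ [a]) (\<lambda>_. 0) l = 2 ^ fold upd (u @ [a]) (\<lambda>_. 0) k"
    using Tr_ratio_step[OF p(5)] by simp
  moreover have "step \<delta> (p' i) (Some ((u @ [a]) ! i)) (p' (Suc i))" if "i < length (u @ [a])" for i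
    using that p(2,4) by (auto simp: p'_def nth_append less_Suc_eq intro: step.Tr)
  moreover have "p' i \<in> locs M N" if "i \<le> length (u @ [a])" for i
    using that p(3) snoc.prems(2,3) by (auto simp: p'_def le_Suc_eq locs_def)
  moreover have "p' 0 \<in> init" "p' (length (u @ [a])) = Tr k l" using p(1) by (simp_all add: p'_def)
  ultimately show ?case by blast
qed

text \<open>A word outside the language is caught by \<open>Ctl\<close> with weight -2 and all
  factors 4; otherwise a tracker reaches a failing guard and challenges it there.\<close>

lemma run_upper:
  assumes regs: "\<And>a. a \<in> set u \<Longrightarrow> regs a \<subseteq> {..<N}" and "u \<notin> L \<or> \<not> valid x u (\<lambda>_. 0)"
  shows "\<exists>p. p 0 \<in> init \<and> (\<forall>i\<le>length u. p i \<in> locs M N) \<and>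
    (\<forall>i<length u. step \<delta> (p i) (Some (u ! i)) (p (Suc i))) \<and>
    real_of_rat (outw F x (p (length u))) * dprod p (\<lambda>i. Some (u ! i)) (length u) \<le> - 2 / 4 ^ length u"
proof (cases "u \<in> L")
  case False
  let ?p = "\<lambda>i. Ctl (foldl \<delta> q0 (take i u))"
  have "foldl \<delta> q0 v < M" for v by (induction v rule: rev_induct) (simp_all add: q0 \<delta>)
  moreover have "step \<delta> (?p i) (Some (u ! i)) (?p (Suc i))" if "i < length u" for i
    using step.Ctl[of \<delta> "foldl \<delta> q0 (take i u)" "u ! i"] that by (simp add: take_Suc_conv_app_nth)
  moreover have "foldl \<delta> q0 u \<notin> F" using False acc by simp
  ultimately show ?thesis
    by (intro exI[of _ ?p]) (auto simp: starts_def locs_def dprod_def power_one_over)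
next
  case True
  \<comment> \<open>Any failing guard will do, not just the earliest: \<open>upd\<close> defines the
    contents regardless of the guards before.\<close>
  with assms(2) obtain m where m: "m < length u" "\<not> guard x (u ! m) (fold upd (take m u) (\<lambda>_. 0))"
    by (auto simp: valid_nth)
  let ?\<sigma> = "fold upd (take m u) (\<lambda>_. 0)"
  have "regs (u ! m) \<subseteq> {..<N}" using regs m(1) by simp
  then obtain k l E where E: "k < N" "l < N" "E \<in> {Err, ErrLo, ErrHi}"
    "step \<delta> (Tr k l) (Some (u ! m)) E"
    "\<And>R. R * 2 ^ ?\<sigma> l = 2 ^ ?\<sigma> k \<Longrightarrow> real_of_rat (outw F x E) * R \<le> - 2"
  proof (cases "u ! m")
    case (Leq k l)
    have "real_of_rat (outw F x Err) * R \<le> - 2" if "R * 2 ^ ?\<sigma> l = 2 ^ ?\<sigma> k" for R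
      using Tr_ratio_ge[OF that, of 1 0] m(2) Leq by simp
    then show ?thesis using that[of k l Err] Leq \<open>regs (u ! m) \<subseteq> {..<N}\<close> by (auto intro: step.intros)
  next
    case InLe
    have "real_of_rat (outw F x ErrLo) * R \<le> - 2" if "R * 2 ^ ?\<sigma> 1 = 2 ^ ?\<sigma> 0" for R
      using Tr_ratio_ge[OF that, of "Suc x" 0] m(2) InLe
      by (simp add: of_rat_divide of_rat_power of_rat_minus field_simps)
    then show ?thesis using that[of 0 1 ErrLo] InLe \<open>regs (u ! m) \<subseteq> {..<N}\<close> step.fail_InLe by auto
  next
    case InGe
    have "real_of_rat (outw F x ErrHi) * R \<le> - 2" if "R * 2 ^ ?\<sigma> 0 = 2 ^ ?\<sigma> 1" for R
      using Tr_ratio_ge[OF that, of 1 x] m(2) InGe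
      by (simp add: of_rat_power of_rat_minus mult.commute)
    then show ?thesis using that[of 1 0 ErrHi] InGe \<open>regs (u ! m) \<subseteq> {..<N}\<close> step.fail_InGe by auto
  qed (use m(2) in auto)
  have "\<exists>p. p 0 \<in> init \<and> p (length (take m u)) = Tr k l \<and> (\<forall>i\<le>length (take m u). p i \<in> locs M N) \<and>
    (\<forall>i<length (take m u). step \<delta> (p i) (Some (take m u ! i)) (p (Suc i))) \<and>
    dprod p (\<lambda>i. Some (take m u ! i)) (length (take m u)) * 4 ^ length (take m u) * 2 ^ ?\<sigma> l = 2 ^ ?\<sigma> k"
    by (rule track) (use regs E(1,2) in \<open>auto dest: in_set_takeD\<close>)
  then obtain p where p: "p 0 \<in> init" "p m = Tr k l" "\<forall>i\<le>m. p i \<in> locs M N"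
    "\<forall>i<m. step \<delta> (p i) (Some (u ! i)) (p (Suc i))"
    "dprod p (\<lambda>i. Some (take m u ! i)) m * 4 ^ m * 2 ^ ?\<sigma> l = 2 ^ ?\<sigma> k"
    using m(1) by auto
  let ?p = "\<lambda>i. if i \<le> m then p i else E" and ?w = "\<lambda>i. Some (u ! i)"
  have "step \<delta> (?p i) (Some (u ! i)) (?p (Suc i))" for i
    using p(2,4) E(3,4) by (cases i m rule: linorder_cases) (auto intro: step.intros)
  moreover have "?p i \<in> locs M N" for i using p(3) E(3) by (auto simp: locs_def)
  moreover have "real_of_rat (outw F x (?p (length u))) * dprod ?p ?w (length u) \<le> - 2 / 4 ^ length u"
  proof -
    have "dprod ?p ?w m = dprod p (\<lambda>i. Some (take m u ! i)) m"
      unfolding dprod_def by (intro prod.cong) auto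
    \<comment> \<open>From the challenge on every factor is 4, which freezes the ratio reached at
      \<open>m\<close>.\<close>
    moreover have "dprod ?p ?w i * 4 ^ i = dprod ?p ?w m * 4 ^ m" if "m \<le> i" for i
      using that
    proof (induction i rule: dec_induct)
      case (step i)
      have "disc (?p i) (?w i) (?p (Suc i)) = 4" using step(1) E(3) p(2) by auto
      then show ?case using step(3) by simp
    qed simp
    ultimately have "dprod ?p ?w (length u) * 4 ^ length u * 2 ^ ?\<sigma> l = 2 ^ ?\<sigma> k"
      using p(5) m(1) by simp
    from E(5)[OF this] show ?thesis using m(1) by (simp add: field_simps)
  qed
  ultimately show ?thesis using p(1) by (intro exI[of _ ?p]) simp
qed

lemma init_locs: "init \<subseteq> locs M N" "insert Ref init \<subseteq> locs M N"
  using q0 by (auto simp: starts_def locs_def)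

lemma extend_path:
  assumes "p 0 \<in> I" "\<forall>i\<le>h. p i \<in> locs M N" "\<forall>i<h. step \<delta> (p i) (w i) (p (Suc i))"
    and "\<forall>i\<in>D. w i \<in> letters N"
  shows "(\<lambda>i. if i \<le> h then p i else Sink) \<in> paths \<delta> M N I D w"
proof -
  have "Sink \<in> locs M N" by (simp add: locs_def)
  then show ?thesis using assms by (auto simp: paths_def arcs_def Suc_le_eq intro: step.Sink)
qed

lemma pval_first:
  assumes "h \<in> D" "w h = None" "\<And>i. i < h \<Longrightarrow> w i = Some (u i)"
  shows "pval F x D w p = real_of_rat (outw F x (p h)) * dprod p w h"
proof -
  have "(LEAST h. w h = None) = h"
    using assms(2,3) by (intro Least_equality) (auto simp: not_less[symmetric])
  then show ?thesis using assms(1,2) by (auto simp: pval_def)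
qed

lemma pval_prefix:
  assumes "h \<in> D" "w h = None" "\<And>i. i < h \<Longrightarrow> w i = Some (u i)"
  shows "pval F x D w (\<lambda>i. if i \<le> h then p i else Sink) =
    real_of_rat (outw F x (p h)) * dprod p (\<lambda>i. Some (u i)) h"
proof -
  have "dprod (\<lambda>i. if i \<le> h then p i else Sink) w h = dprod p (\<lambda>i. Some (u i)) h"
    unfolding dprod_def by (intro prod.cong) (auto simp: assms(3))
  then show ?thesis using pval_first[of h D w u x, OF assms] by simp
qed

context
  fixes D :: "nat set" and w :: "nat \<Rightarrow> op option" and x :: nat
  assumes D: "\<And>i j. i \<in> D \<Longrightarrow> j \<le> i \<Longrightarrow> j \<in> D" and w: "\<forall>i\<in>D. w i \<in> letters N"
begin

text \<open>Each run from \<open>Ref\<close> is matched by a run from \<open>init\<close> of at most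
  the same value, obtained by refuting the prefix before the first end letter.\<close>

lemma INF_eq_if_not_halting:
  assumes "\<And>u. u \<in> L \<Longrightarrow> \<not> valid x u (\<lambda>_. 0)"
  shows "(INF p\<in>paths \<delta> M N (insert Ref init) D w. ereal (pval F x D w p)) =
    (INF p\<in>paths \<delta> M N init D w. ereal (pval F x D w p))"
proof (rule antisym)
  show "(INF p\<in>paths \<delta> M N (insert Ref init) D w. ereal (pval F x D w p)) \<le>
    (INF p\<in>paths \<delta> M N init D w. ereal (pval F x D w p))"
    by (rule INF_superset_mono) (auto simp: paths_def)
next
  show "(INF p\<in>paths \<delta> M N init D w. ereal (pval F x D w p)) \<le>
    (INF p\<in>paths \<delta> M N (insert Ref init) D w. ereal (pval F x D w p))"
  proof (rule INF_mono)
    fix p assume p: "p \<in> paths \<delta> M N (insert Ref init) D w"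
    show "\<exists>p'\<in>paths \<delta> M N init D w. ereal (pval F x D w p') \<le> ereal (pval F x D w p)"
    proof (cases "p 0 = Ref")
      case False
      then have "p \<in> paths \<delta> M N init D w" using p by (simp add: paths_def)
      then show ?thesis by blast
    next
      case Ref: True
      show ?thesis
      proof (cases "\<exists>h\<in>D. w h = None")
        case False
        then have "pval F x D w p' = 0" for p' by (auto simp: pval_def)
        \<comment> \<open>All runs have value 0 here, and it remains to see that \<open>init\<close>
          offers a run at all.\<close>
        moreover have "(\<lambda>i. if i \<le> 0 then Ctl q0 else Sink) \<in> paths \<delta> M N init D w"
          by (rule extend_path) (use w q0 in \<open>auto simp: starts_def locs_def\<close>)
        ultimately show ?thesis by (metis order_refl)
      next
        case True
        define h where "h = (LEAST h. w h = None)"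
        have h: "w h = None" "h \<in> D" "\<And>i. i < h \<Longrightarrow> w i \<noteq> None"
          using True D unfolding h_def by (auto intro: LeastI dest: not_less_Least Least_le)
        define u where "u = map (\<lambda>i. the (w i)) [0..<h]"
        have u: "length u = h" "\<And>i. i < h \<Longrightarrow> w i = Some (u ! i)"
          using h(3) by (auto simp: u_def)
        have "step \<delta> (p i) (w i) (p (Suc i))" if "i < h" for i
          using p D[OF h(2), of i] that by (auto simp: paths_def arcs_def)
        then have "- 2 / 4 ^ h \<le> pval F x D w p"
          using run_Ref[of p h w x] Ref pval_first[of h D w "(!) u" x p] h(1,2) u(2) by simp
        moreover have "regs a \<subseteq> {..<N}" if "a \<in> set u" for a
        proof -
          from that obtain i where "i < h" "a = u ! i" using u(1) by (metis in_set_conv_nth)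
          then have "Some a \<in> letters N" using u(2) w D[OF h(2), of i] by (metis less_imp_le)
          then show ?thesis by (auto simp: letters_def)
        qed
        then obtain p' where p': "p' 0 \<in> init" "\<forall>i\<le>h. p' i \<in> locs M N"
          "\<forall>i<h. step \<delta> (p' i) (Some (u ! i)) (p' (Suc i))"
          "real_of_rat (outw F x (p' h)) * dprod p' (\<lambda>i. Some (u ! i)) h \<le> - 2 / 4 ^ h"
          using run_upper[of u x] assms u(1) by metis
        moreover have "(\<lambda>i. if i \<le> h then p' i else Sink) \<in> paths \<delta> M N init D w"
          by (rule extend_path) (use p' w u(2) in auto)
        moreover have "pval F x D w (\<lambda>i. if i \<le> h then p' i else Sink) =
            real_of_rat (outw F x (p' h)) * dprod p' (\<lambda>i. Some (u ! i)) h"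
          by (rule pval_prefix) (use h u(2) in auto)
        ultimately show ?thesis by (metis (no_types, lifting) ereal_less_eq(3) order_trans)
      qed
    qed
  qed
qed

text \<open>The uniform bound \<open>- 1 / 4 ^ n\<close> of \<open>run_lower\<close> survives the
  infimum, and the reference run lies strictly below it.\<close>

lemma INF_neq_if_halting:
  assumes "u \<in> L" "valid x u (\<lambda>_. 0)" "length u \<in> D" "w (length u) = None"
    and u: "\<And>i. i < length u \<Longrightarrow> w i = Some (u ! i)"
  shows "(INF p\<in>paths \<delta> M N (insert Ref init) D w. ereal (pval F x D w p)) \<noteq>
    (INF p\<in>paths \<delta> M N init D w. ereal (pval F x D w p))"
proof -
  let ?h = "length u"
  have "(\<lambda>i. if i \<le> ?h then Ref else Sink) \<in> paths \<delta> M N (insert Ref init) D w"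
    by (rule extend_path) (use w u in \<open>auto simp: locs_def intro: step.Ref\<close>)
  moreover have "pval F x D w (\<lambda>i. if i \<le> ?h then Ref else Sink) = - 2 / 4 ^ ?h"
    using pval_prefix[of ?h D w "(!) u" x "\<lambda>_. Ref", OF assms(3,4) u]
    by (simp add: dprod_def power_one_over)
  ultimately have "(INF p\<in>paths \<delta> M N (insert Ref init) D w. ereal (pval F x D w p)) \<le> ereal (- 2 / 4 ^ ?h)"
    by (metis (no_types, lifting) INF_lower)
  also have "\<dots> < ereal (- 1 / 4 ^ ?h)" by (simp add: divide_strict_right_mono)
  also have "\<dots> \<le> (INF p\<in>paths \<delta> M N init D w. ereal (pval F x D w p))"
  proof (rule INF_greatest)
    fix p assume p: "p \<in> paths \<delta> M N init D w"
    have "step \<delta> (p i) (w i) (p (Suc i))" if "i < ?h" for i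
      using p D[OF assms(3), of i] that by (auto simp: paths_def arcs_def)
    then have "- 1 / 4 ^ ?h \<le> real_of_rat (outw F x (p ?h)) * dprod p w ?h"
      using p by (intro run_lower[OF _ _ u assms(2,1)]) (auto simp: paths_def)
    then show "ereal (- 1 / 4 ^ ?h) \<le> ereal (pval F x D w p)"
      using pval_first[of ?h D w "(!) u" x p, OF assms(3,4) u] by simp
  qed
  finally show ?thesis by simp
qed

end

abbreviation autA :: "nat \<Rightarrow> (nat, nat) nmda" where
  "autA x \<equiv> aut \<delta> F M N x (insert Ref init)"

abbreviation autB :: "nat \<Rightarrow> (nat, nat) nmda" where
  "autB x \<equiv> aut \<delta> F M N x init"

lemma alphabet_aut: "alphabet (aut \<delta> F M N x I) = to_nat ` letters N"
  by (simp add: aut_def)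

lemma letters_regs: "u \<in> L \<Longrightarrow> a \<in> set u \<Longrightarrow> Some a \<in> letters N"
  using regs by (auto simp: letters_def)

section \<open>Equivalence of the automata and acceptance\<close>

theorem finite_equivalent_iff:
  "(\<forall>w\<in>finite_words (alphabet (autA x)). finite_word_value (autA x) w = finite_word_value (autB x) w)
    \<longleftrightarrow> (\<forall>u\<in>L. \<not> valid x u (\<lambda>_. 0))"
proof
  assume *: "\<forall>u\<in>L. \<not> valid x u (\<lambda>_. 0)"
  show "\<forall>w\<in>finite_words (alphabet (autA x)). finite_word_value (autA x) w = finite_word_value (autB x) w"
  proof
    fix w assume "w \<in> finite_words (alphabet (autA x))"
    then have w: "set w \<subseteq> to_nat ` letters N" by (simp add: finite_words_def alphabet_aut)
    have l: "(from_nat \<circ> (!) w) i \<in> letters N" if "i < length w" for i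
    proof -
      have "w ! i \<in> to_nat ` letters N" using that w nth_mem by blast
      then show ?thesis by auto
    qed
    show "finite_word_value (autA x) w = finite_word_value (autB x) w"
      unfolding finite_word_value_aut[OF w] by (rule INF_eq_if_not_halting) (use * l in auto)
  qed
next
  assume *: "\<forall>w\<in>finite_words (alphabet (autA x)). finite_word_value (autA x) w = finite_word_value (autB x) w"
  show "\<forall>u\<in>L. \<not> valid x u (\<lambda>_. 0)"
  proof (intro ballI notI)
    fix u assume u: "u \<in> L" "valid x u (\<lambda>_. 0)"
    \<comment> \<open>The end letter also makes the word nonempty when the computation is
      empty.\<close>
    let ?u = "map Some u @ [None]"
    let ?w = "map to_nat ?u"
    have nth: "(from_nat \<circ> (!) ?w) i = ?u ! i" if "i < Suc (length u)" for i
    proof -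
      have "?w ! i = to_nat (?u ! i)" by (rule nth_map) (use that in simp)
      then show ?thesis by (simp only: comp_def from_nat_to_nat)
    qed
    have "set ?u \<subseteq> letters N" using letters_regs[OF u(1)] by (auto simp: letters_def)
    then have w: "set ?w \<subseteq> to_nat ` letters N" by auto
    have "finite_word_value (autA x) ?w \<noteq> finite_word_value (autB x) ?w"
      unfolding finite_word_value_aut[OF w]
    proof (rule INF_neq_if_halting[OF _ _ u])
      show "\<forall>i\<in>{..<length ?w}. (from_nat \<circ> (!) ?w) i \<in> letters N"
        using \<open>set ?u \<subseteq> letters N\<close> nth by (metis (no_types, lifting) length_append_singleton length_map lessThan_iff nth_mem subset_code(1))
      show "(from_nat \<circ> (!) ?w) (length u) = (None :: op option)" using nth[of "length u"] by (simp add: nth_append)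
      show "(from_nat \<circ> (!) ?w) i = Some (u ! i)" if "i < length u" for i
        using nth[of i] that by (simp add: nth_append)
    qed auto
    moreover have "?w \<in> finite_words (alphabet (autA x))"
      using w by (simp add: finite_words_def alphabet_aut)
    ultimately show False using * by blast
  qed
qed

theorem infinite_equivalent_iff:
  "(\<forall>w\<in>infinite_words (alphabet (autA x)). infinite_word_value (autA x) w = infinite_word_value (autB x) w)
    \<longleftrightarrow> (\<forall>u\<in>L. \<not> valid x u (\<lambda>_. 0))"
proof
  assume *: "\<forall>u\<in>L. \<not> valid x u (\<lambda>_. 0)"
  show "\<forall>w\<in>infinite_words (alphabet (autA x)). infinite_word_value (autA x) w = infinite_word_value (autB x) w"
  proof
    fix w assume "w \<in> infinite_words (alphabet (autA x))"
    then have w: "w i \<in> to_nat ` letters N" for i by (simp add: infinite_words_def alphabet_aut)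
    have l: "(from_nat \<circ> w) i \<in> letters N" for i using w[of i] by auto
    show "infinite_word_value (autA x) w = infinite_word_value (autB x) w"
      unfolding infinite_word_value_aut[OF w] by (rule INF_eq_if_not_halting) (use * l in auto)
  qed
next
  assume *: "\<forall>w\<in>infinite_words (alphabet (autA x)). infinite_word_value (autA x) w = infinite_word_value (autB x) w"
  show "\<forall>u\<in>L. \<not> valid x u (\<lambda>_. 0)"
  proof (intro ballI notI)
    fix u assume u: "u \<in> L" "valid x u (\<lambda>_. 0)"
    let ?u = "\<lambda>i. if i < length u then Some (u ! i) else None"
    let ?w = "\<lambda>i. to_nat (?u i)"
    have nth: "(from_nat \<circ> ?w) i = ?u i" for i by simp
    have l: "?u i \<in> letters N" for i using letters_regs[OF u(1)] by (auto simp: letters_def)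
    then have w: "?w i \<in> to_nat ` letters N" for i by blast
    have "infinite_word_value (autA x) ?w \<noteq> infinite_word_value (autB x) ?w"
      unfolding infinite_word_value_aut[OF w]
      by (rule INF_neq_if_halting[OF _ _ u]) (use l nth in auto)
    moreover have "?w \<in> infinite_words (alphabet (autA x))"
      using w by (simp add: infinite_words_def alphabet_aut)
    ultimately show False using * by blast
  qed
qed

end

section \<open>Undecidability\<close>

abbreviation lo_arc :: "nat \<times> nat \<times> nat" where "lo_arc \<equiv> enc_arc (ErrLo, None, Sink)"
abbreviation hi_arc :: "nat \<times> nat \<times> nat" where "hi_arc \<equiv> enc_arc (ErrHi, None, Sink)"

definition arc_code :: "(nat, nat) nmda \<Rightarrow> nat \<times> nat \<times> nat \<Rightarrow> nat" where
  "arc_code A t = list_encode [trans_code t, rat_code (weight A t), rat_code (discount A t)]"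

text \<open>The middle entry is the code of \<open>- 1 / 2 ^ x\<close>: the numerator -1 is coded as
  1 and the denominator as twice \<open>2 ^ x\<close>. Doubling is written as a sum to match the
  recursive functions at hand; \<open>hi_code\<close> treats \<open>- (2 ^ x)\<close>
  likewise.\<close>

definition lo_code :: "nat \<Rightarrow> nat" where
  "lo_code x = list_encode [trans_code lo_arc, prod_encode (1, 2 ^ x + 2 ^ x), rat_code 4]"

definition hi_code :: "nat \<Rightarrow> nat" where
  "hi_code x = list_encode
    [trans_code hi_arc, prod_encode (Suc ((2 ^ x - 1) + (2 ^ x - 1)), int_encode 1), rat_code 4]"

text \<open>Only the weights of the two arcs \<open>lo_arc\<close> and \<open>hi_arc\<close> depend on \<open>x\<close>, so the code of an
  instance is a simple function of \<open>x\<close> and of five numbers that depend on the program only.\<close>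

definition instance_code :: "nat list \<Rightarrow> nat" where
  "instance_code xs = (let T = xs ! 4 + 2 ^ lo_code (xs ! 5) + 2 ^ hi_code (xs ! 5) in
    prod_encode (list_encode [xs ! 0, xs ! 1, xs ! 2, T], list_encode [xs ! 0, xs ! 1, xs ! 3, T]))"

lemma total_rec_instance_code: "total_rec 6 instance_code"
proof -
  note intros = total_rec_proj total_rec_const total_rec_add total_rec_pow2 total_rec_pred
    total_rec_Suc total_rec_prod_encode
  show ?thesis
    unfolding instance_code_def lo_code_def hi_code_def Let_def list_encode.simps
    by (intro intros) simp_all
qed

lemma nmda_code_arc_code:
  "nmda_code A = list_encode [set_encode (alphabet A), set_encode (states A), set_encode (initial A),
    set_encode (arc_code A ` transitions A)]"
  unfolding nmda_code_def arc_code_def[abs_def] by (rule refl)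

lemma rat_code_Fract:
  assumes "0 < d" "coprime n d"
  shows "rat_code (of_int n / of_int d) = prod_encode (int_encode n, int_encode d)"
proof -
  have "quotient_of (of_int n / of_int d) = (n, d)"
    using assms by (simp add: quotient_of_Fract normalize_stable flip: Fract_of_int_quotient)
  then show ?thesis by (simp add: rat_code_def)
qed

lemma arc_code_aut:
  "arc_code (aut \<delta> F M N x I) lo_arc = lo_code x"
  "arc_code (aut \<delta> F M N x I) hi_arc = hi_code x"
proof -
  have "rat_code (- 1 / 2 ^ x) = prod_encode (int_encode (-1), int_encode (2 ^ x))"
    using rat_code_Fract[of "2 ^ x" "-1"] by simp
  also have "\<dots> = prod_encode (1, 2 ^ x + 2 ^ x)"
    by (simp add: int_encode_def sum_encode_def nat_power_eq)
  finally show "arc_code (aut \<delta> F M N x I) lo_arc = lo_code x"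
    by (simp add: arc_code_def aut_def enc_arc_def lo_code_def)
  have "rat_code (- (2 ^ x)) = prod_encode (int_encode (- (2 ^ x)), int_encode 1)"
    using rat_code_Fract[of 1 "- (2 ^ x)"] by simp
  also have "int_encode (- (2 ^ x)) = Suc ((2 ^ x - 1) + (2 ^ x - 1))"
    by (simp add: int_encode_def sum_encode_def nat_diff_distrib nat_power_eq)
  finally show "arc_code (aut \<delta> F M N x I) hi_arc = hi_code x"
    by (simp add: arc_code_def aut_def enc_arc_def hi_code_def)
qed

lemma enc_arc_inject: "enc_arc t = enc_arc u \<longleftrightarrow> t = u"
  by (cases t; cases u) (auto simp: enc_arc_def)

lemma inj_arc_code: "inj (arc_code A)"
proof (rule injI)
  fix t u assume "arc_code A t = arc_code A u"
  then have "trans_code t = trans_code u" unfolding arc_code_def list_encode_eq by simp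
  then show "t = u" using inj_trans_code by (rule injD[rotated])
qed

text \<open>Only arcs that read \<open>None\<close> out of \<open>ErrLo\<close> or
  \<open>ErrHi\<close> see \<open>x\<close>, and such arcs lead to \<open>Sink\<close>, so they are
  the two that are removed.\<close>

lemma arc_code_other:
  assumes "t \<in> enc_arc ` arcs \<delta> M N - {lo_arc, hi_arc}"
  shows "arc_code (aut \<delta> F M N x I) t = arc_code (aut \<delta> F M N 0 {}) t"
proof -
  from assms obtain p b q where t: "t = enc_arc (p, b, q)" "(p, b, q) \<in> arcs \<delta> M N" by auto
  have "b = None \<Longrightarrow> q = Sink" using t(2) step_to_Sink by (auto simp: arcs_def)
  then have "b = None \<Longrightarrow> p \<noteq> ErrLo \<and> p \<noteq> ErrHi" using assms t(1) by auto
  then have "b = None \<Longrightarrow> outw F x p = outw F 0 p" by (cases p) auto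
  then show ?thesis unfolding t(1) arc_code_def by (simp add: enc_arc_def aut_def)
qed

lemma finite_arcs: "finite (arcs \<delta> M N)"
proof (rule finite_subset)
  show "arcs \<delta> M N \<subseteq> locs M N \<times> letters N \<times> locs M N" by (auto simp: arcs_def)
qed (simp add: finite_locs finite_letters)

context program_dfa
begin

text \<open>The instance with 0 and \<open>{}\<close> is an arbitrary representative, as
  \<open>arc_code_other\<close> shows.\<close>

definition fixed_arcs :: nat where
  "fixed_arcs = set_encode (arc_code (aut \<delta> F M N 0 {}) ` (enc_arc ` arcs \<delta> M N - {lo_arc, hi_arc}))"

text \<open>A set is coded as a sum of powers of 2, so the two arcs depending on \<open>x\<close>
  split off as separate summands, provided that their codes differ from each other and from the
  rest.\<close>

lemma set_encode_arcs:
  "set_encode (arc_code (aut \<delta> F M N x I) ` enc_arc ` arcs \<delta> M N) =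
    fixed_arcs + 2 ^ lo_code x + 2 ^ hi_code x"
proof -
  let ?A = "aut \<delta> F M N x I" and ?T = "enc_arc ` arcs \<delta> M N"
  have "(ErrLo, None, Sink) \<in> arcs \<delta> M N" "(ErrHi, None, Sink) \<in> arcs \<delta> M N"
    by (auto simp: arcs_def locs_def letters_def intro: step.Sink)
  then have T: "?T = insert lo_arc (insert hi_arc (?T - {lo_arc, hi_arc}))" by blast
  let ?B = "arc_code ?A ` (?T - {lo_arc, hi_arc})"
  have "lo_arc \<noteq> hi_arc" by (simp add: enc_arc_inject)
  then have "arc_code ?A lo_arc \<notin> insert (arc_code ?A hi_arc) ?B" "arc_code ?A hi_arc \<notin> ?B"
    using inj_arc_code[of ?A] by (auto dest: injD)
  moreover have "arc_code ?A ` ?T = insert (arc_code ?A lo_arc) (insert (arc_code ?A hi_arc) ?B)"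
    by (subst T) (simp only: image_insert)
  ultimately have "set_encode (arc_code ?A ` ?T) = set_encode ?B + 2 ^ lo_code x + 2 ^ hi_code x"
    by (simp add: set_encode_def finite_arcs arc_code_aut del: image_insert)
  also have "arc_code ?A ` (?T - {lo_arc, hi_arc}) =
    arc_code (aut \<delta> F M N 0 {}) ` (?T - {lo_arc, hi_arc})"
    by (intro image_cong refl arc_code_other)
  finally show ?thesis by (simp add: fixed_arcs_def)
qed

text \<open>No entry mentions \<open>x\<close>; this is what allows \<open>x\<close> to be defined
  from them.\<close>

definition params :: "nat list" where
  "params = [set_encode (to_nat ` letters N), set_encode (to_nat ` locs M N),
    set_encode (to_nat ` insert Ref init), set_encode (to_nat ` init), fixed_arcs]"

lemma nmda_pair_code_aut: "nmda_pair_code (autA x, autB x) = instance_code (params @ [x])"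
proof -
  have "nmda_code (aut \<delta> F M N x I) = list_encode [set_encode (to_nat ` letters N),
    set_encode (to_nat ` locs M N), set_encode (to_nat ` I), fixed_arcs + 2 ^ lo_code x + 2 ^ hi_code x]" for I
    unfolding nmda_code_arc_code set_encode_arcs[of x I, symmetric] by (simp add: aut_def)
  then show ?thesis
    by (simp add: nmda_pair_code_def instance_code_def params_def Let_def del: list_encode.simps)
qed

lemma aut_pair: "(autA x, autB x) \<in> integral_nmda_pairs"
  using aut_wf[OF init_locs(1)] aut_wf[OF init_locs(2)] alphabet_aut
  by (simp add: integral_nmda_pairs_def)

end

section \<open>The diagonal argument\<close>

lemma impl_guess:
  assumes "1 < s"
  shows "impl rs s 1 (\<lambda>_ ys. \<exists>y. ys = [y] \<and> True)"
proof -
  let ?L = "conc {[Copy s 1]} (star {[Inc s]})"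
  have frame: "k \<noteq> s \<Longrightarrow> \<tau> k = \<sigma> k" if "(run x {[Inc s]})\<^sup>*\<^sup>* \<sigma> \<tau>" for x \<sigma> \<tau> k
    using that by induction auto
  have reach: "(run x {[Inc s]})\<^sup>*\<^sup>* (\<sigma>(s := 0)) (\<sigma>(s := n))" for x \<sigma> n
  proof (induction n)
    case (Suc n)
    have "run x {[Inc s]} (\<sigma>(s := n)) (\<sigma>(s := Suc n))" by simp
    with Suc show ?case by (rule rtranclp.rtrancl_into_rtrancl[of "run x {[Inc s]}"])
  qed simp
  have "implements ?L rs s 1 (\<lambda>_ ys. \<exists>y. ys = [y] \<and> True)"
  proof (rule implementsI)
    fix x \<sigma> \<tau> k assume "run x ?L \<sigma> \<tau>" "k < s"
    then obtain \<rho> where "run x {[Copy s 1]} \<sigma> \<rho>" "(run x {[Inc s]})\<^sup>*\<^sup>* \<rho> \<tau>"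
      unfolding run_conc run_star by blast
    then show "\<tau> k = \<sigma> k" using frame[of x \<rho> \<tau> k] \<open>k < s\<close> by simp
  next
    fix x and \<sigma> :: "nat \<Rightarrow> nat" and ys :: "nat list" assume \<sigma>: "\<sigma> 1 = 0" and "\<exists>y. ys = [y] \<and> True"
    then obtain y where "ys = [y]" by blast
    moreover have "run x ?L \<sigma> (\<sigma>(s := y))"
      unfolding run_conc run_star using reach[of x \<sigma> y] \<sigma> by auto
    ultimately show "\<exists>\<tau>. run x ?L \<sigma> \<tau> \<and> map \<tau> [s..<s + 1] = ys" by fastforce
  qed simp
  then show ?thesis by (rule implI) (intro prog_intros)
qed

text \<open>The program guesses a parameter vector, checks that the instance parameter \<open>x\<close> is its code,
  and accepts if \<open>h\<close> maps the vector and \<open>x\<close> to 1. With \<open>x\<close> coding the parameters of the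
  program's own automata, the program thus has access to its own instance.\<close>

lemma diagonal_program:
  "\<exists>L. prog L \<and> (\<forall>x. (\<exists>u\<in>L. valid x u (\<lambda>_. 0)) \<longleftrightarrow>
    (\<exists>cs. length cs = 5 \<and> list_encode cs = x \<and> rec_eval h (cs @ [x]) 1))"
proof -
  have "impl [] 2 (length (replicate 5 (\<lambda>(_::nat list) (_::nat). True)))
      (\<lambda>xs. list_all2 (\<lambda>R y. R xs y) (replicate 5 (\<lambda>_ _. True)))"
  proof (rule impl_list)
    fix R and s' :: nat assume "R \<in> set (replicate 5 (\<lambda>(_::nat list) (_::nat). True))" "2 \<le> s'"
    then have "R = (\<lambda>_ _. True)" "1 < s'" by auto
    then show "impl [] s' 1 (\<lambda>xs ys. \<exists>y. ys = [y] \<and> R xs y)" using impl_guess[of s'] by simp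
  qed auto
  then obtain L1 where L1: "prog L1"
    "implements L1 [] 2 5 (\<lambda>xs. list_all2 (\<lambda>R y. R xs y) (replicate 5 (\<lambda>_ _. True)))"
    unfolding impl_def by auto
  have "total_rec 5 (\<lambda>xs. list_encode (map (\<lambda>f. f xs) (map (\<lambda>i xs. xs ! i) [0..<5])))"
    by (rule total_rec_list_encode) (auto intro: total_rec_proj)
  then obtain e where e: "rec_eval e xs (list_encode xs)" if "length xs = 5" for xs
    unfolding total_rec_def map_map comp_def by (metis map_nth)
  obtain L2 where L2: "prog L2"
    "implements L2 [2..<7] 7 1 (\<lambda>xs ys. \<exists>y. ys = [y] \<and> rec_eval e xs y)"
    using impl_recf[of "[2..<7]" 7 e] unfolding impl_def by auto
  obtain L3 where L3: "prog L3"
    "implements L3 ([2..<7] @ [0]) 8 1 (\<lambda>xs ys. \<exists>y. ys = [y] \<and> rec_eval h xs y)"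
    using impl_recf[of "[2..<7] @ [0]" 8 h] unfolding impl_def by auto
  \<comment> \<open>The code computed in register 7 moves to register 0 and is compared with
    \<open>x\<close> in both directions. Register 0 then equals \<open>x\<close> and serves as the
    last argument of \<open>h\<close>.\<close>
  let ?C = "conc {[Copy 0 7]} (conc {[InLe]} {[InGe]})"
  \<comment> \<open>Register 9 is set to 1, and the result of \<open>h\<close> in register 8 must
    equal it.\<close>
  let ?E = "conc {[Copy 9 1]} (conc {[Inc 9]} (conc {[Leq 8 9]} {[Leq 9 8]}))"
  let ?L = "conc L1 (conc L2 (conc ?C (conc L3 ?E)))"
  have upt: "[2..<2 + 5] = [2..<7::nat]" by simp
  have "(\<exists>u\<in>?L. valid x u (\<lambda>_. 0)) \<longleftrightarrow>
    (\<exists>cs. length cs = 5 \<and> list_encode cs = x \<and> rec_eval h (cs @ [x]) 1)" for x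
  proof
    assume "\<exists>u\<in>?L. valid x u (\<lambda>_. 0)"
    then have "\<exists>\<tau>. run x ?L (\<lambda>_. 0) \<tau>" unfolding run_def by blast
    then obtain \<rho>1 \<rho>2 \<rho>3 \<rho>4 \<tau> where \<rho>: "run x L1 (\<lambda>_. 0) \<rho>1" "run x L2 \<rho>1 \<rho>2" "run x ?C \<rho>2 \<rho>3"
      "run x L3 \<rho>3 \<rho>4" "run x ?E \<rho>4 \<tau>"
      unfolding run_conc[of _ L1] run_conc[of _ L2] run_conc[of _ ?C] run_conc[of _ L3] by blast
    note 1 = implements_sound[OF L1(2) refl \<rho>(1)]
    have "\<rho>1 1 = 0" using 1(1) by simp
    note 2 = implements_sound[OF L2(2) this \<rho>(2)]
    let ?cs = "map \<rho>1 [2..<7]"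
    have "\<rho>2 7 = list_encode ?cs" using 2(2) e[of ?cs] rec_eval_deterministic by auto
    moreover have "\<rho>2 1 = 0" using 2(1) 1(1) by simp
    moreover have \<rho>3: "\<rho>3 = \<rho>2(0 := \<rho>2 7)" "\<rho>2 7 \<le> \<rho>2 1 + x" "\<rho>2 1 + x \<le> \<rho>2 7" using \<rho>(3) by auto
    ultimately have x: "list_encode ?cs = x" "\<rho>3 0 = x" "\<rho>3 1 = 0" by auto
    note 3 = implements_sound[OF L3(2) x(3) \<rho>(4)]
    have "map \<rho>3 ([2..<7] @ [0]) = ?cs @ [x]" using x(2) \<rho>3(1) 2(1) by auto
    then have "rec_eval h (?cs @ [x]) (\<rho>4 8)" using 3(2) by (simp del: map_eq_conv)
    moreover have "\<rho>4 8 = Suc (\<rho>4 1)" "\<rho>4 1 = 0" using \<rho>(5) 3(1) x(3) by auto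
    ultimately have "rec_eval h (?cs @ [x]) 1" by simp
    then show "\<exists>cs. length cs = 5 \<and> list_encode cs = x \<and> rec_eval h (cs @ [x]) 1"
      using x(1) by (intro exI[of _ ?cs]) simp
  next
    assume "\<exists>cs. length cs = 5 \<and> list_encode cs = x \<and> rec_eval h (cs @ [x]) 1"
    then obtain cs where cs: "length cs = 5" "list_encode cs = x" "rec_eval h (cs @ [x]) 1" by blast
    have "list_all2 (\<lambda>R y. R (map (\<lambda>_. 0) []) y) (replicate 5 (\<lambda>_ _. True)) cs"
      using cs(1) by (simp add: list_all2_conv_all_nth)
    then obtain \<rho>1 where "run x L1 (\<lambda>_. 0) \<rho>1" "map \<rho>1 [2..<2 + 5] = cs" "\<forall>k<2. \<rho>1 k = 0"
      using implements_complete[OF L1(2), where \<sigma> = "\<lambda>_. 0" and x = x and ys = cs] by blast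
    then have \<rho>1: "run x L1 (\<lambda>_. 0) \<rho>1" "map \<rho>1 [2..<7] = cs" "\<rho>1 1 = 0" unfolding upt by simp_all
    have "rec_eval e (map \<rho>1 [2..<7]) x" using e[OF cs(1)] cs(2) \<rho>1(2) by simp
    then obtain \<rho>2 where \<rho>2: "run x L2 \<rho>1 \<rho>2" "\<rho>2 7 = x" "\<And>k. k < 7 \<Longrightarrow> \<rho>2 k = \<rho>1 k"
      using implements_single_complete[OF L2(2), where \<sigma> = \<rho>1 and x = x, OF \<rho>1(3)] by blast
    let ?\<rho>3 = "\<rho>2(0 := x)"
    have C: "run x ?C \<rho>2 ?\<rho>3" using \<rho>2(2) \<rho>2(3)[of 1] \<rho>1(3) by simp
    have "map ?\<rho>3 ([2..<7] @ [0]) = cs @ [x]" using \<rho>2(3) \<rho>1(2) by auto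
    then have "rec_eval h (map ?\<rho>3 ([2..<7] @ [0])) 1" using cs(3) by (simp only:)
    moreover have \<rho>3: "?\<rho>3 1 = 0" using \<rho>2(3)[of 1] \<rho>1(3) by simp
    ultimately obtain \<rho>4 where \<rho>4: "run x L3 ?\<rho>3 \<rho>4" "\<rho>4 8 = 1" "\<And>k. k < 8 \<Longrightarrow> \<rho>4 k = ?\<rho>3 k"
      using implements_single_complete[OF L3(2), where \<sigma> = ?\<rho>3 and x = x] by blast
    have "run x ?E \<rho>4 (\<rho>4(9 := 1))" using \<rho>4(2) \<rho>4(3)[of 1] \<rho>3 by simp
    then have "run x ?L (\<lambda>_. 0) (\<rho>4(9 := 1))"
      unfolding run_conc[of _ L1] run_conc[of _ L2] run_conc[of _ ?C] run_conc[of _ L3]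
      using \<rho>1(1) \<rho>2(1) C \<rho>4(1) by blast
    then show "\<exists>u\<in>?L. valid x u (\<lambda>_. 0)" unfolding run_def by blast
  qed
  moreover have "prog ?L" by (intro prog_intros L1(1) L2(1) L3(1))
  ultimately show ?thesis by blast
qed

text \<open>The property \<open>P\<close> is kept abstract so that one diagonal argument serves
  finite and infinite words.\<close>

lemma not_decidable:
  assumes P: "\<And>\<delta> q0 F M N L x. program_dfa \<delta> q0 F M N L \<Longrightarrow>
    P (aut \<delta> F M N x (insert Ref (starts q0 N)), aut \<delta> F M N x (starts q0 N)) \<longleftrightarrow>
      (\<forall>u\<in>L. \<not> valid x u (\<lambda>_. 0))"
  shows "\<not> decidable_problem integral_nmda_pairs nmda_pair_code P"
proof
  assume "decidable_problem integral_nmda_pairs nmda_pair_code P"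
  then obtain d where d: "\<And>I. I \<in> integral_nmda_pairs \<Longrightarrow> rec_eval d [nmda_pair_code I] (if P I then 1 else 0)"
    unfolding decidable_problem_def by blast
  obtain c where c: "\<And>xs. length xs = 6 \<Longrightarrow> rec_eval c xs (instance_code xs)"
    using total_rec_instance_code unfolding total_rec_def by blast
  obtain L where L: "prog L" "\<And>x. (\<exists>u\<in>L. valid x u (\<lambda>_. 0)) \<longleftrightarrow>
    (\<exists>cs. length cs = 5 \<and> list_encode cs = x \<and> rec_eval (Comp d [c]) (cs @ [x]) 1)"
    using diagonal_program[of "Comp d [c]"] by blast
  obtain N where N: "\<And>w a. w \<in> L \<Longrightarrow> a \<in> set w \<Longrightarrow> regs a \<subseteq> {..<N}"
    using L(1) unfolding prog_def by blast
  obtain \<delta> :: "nat \<Rightarrow> op \<Rightarrow> nat" and q0 F M where "q0 < M" "\<And>q a. q < M \<Longrightarrow> \<delta> q a < M"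
    "\<And>w. w \<in> L \<longleftrightarrow> foldl \<delta> q0 w \<in> F"
    using regular_dfa L(1) unfolding prog_def by metis
  then interpret program_dfa \<delta> q0 F M N L by unfold_locales (use N in auto)
  \<comment> \<open>The fixed point: \<open>x\<close> encodes parameters of automata that were built
    without knowing it.\<close>
  define x where "x = list_encode params"
  let ?I = "(autA x, autB x)"
  \<comment> \<open>Injectivity of \<open>list_encode\<close> leaves \<open>params\<close> as the
    only vector that passes the check.\<close>
  have "(\<exists>u\<in>L. valid x u (\<lambda>_. 0)) \<longleftrightarrow> rec_eval (Comp d [c]) (params @ [x]) 1"
  proof -
    have "length params = 5" by (simp add: params_def)
    then show ?thesis unfolding L(2) x_def list_encode_eq by auto
  qed
  also have "\<dots> \<longleftrightarrow> rec_eval d [nmda_pair_code ?I] 1"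
  proof -
    have ev: "rec_eval c (params @ [x]) (nmda_pair_code ?I)"
      unfolding nmda_pair_code_aut by (rule c) (simp add: params_def)
    show ?thesis
    proof
      assume "rec_eval (Comp d [c]) (params @ [x]) 1"
      then obtain y where y: "rec_eval c (params @ [x]) y" "rec_eval d [y] 1"
        by (auto simp: rec_eval_Comp_iff list_all2_Cons1)
      have "y = nmda_pair_code ?I" using y(1) ev by (rule rec_eval_deterministic)
      with y(2) show "rec_eval d [nmda_pair_code ?I] 1" by (simp only:)
    next
      assume "rec_eval d [nmda_pair_code ?I] 1"
      with ev show "rec_eval (Comp d [c]) (params @ [x]) 1"
        by (intro rec_eval.comp[of _ _ "[nmda_pair_code ?I]"]) simp_all
    qed
  qed
  also have "\<dots> \<longleftrightarrow> P ?I"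
    using d[OF aut_pair[of x]] rec_eval_deterministic[of d "[nmda_pair_code ?I]" 0 1]
    by (cases "P ?I") auto
  also have "\<dots> \<longleftrightarrow> (\<forall>u\<in>L. \<not> valid x u (\<lambda>_. 0))"
    by (rule P) (rule program_dfa_axioms)
  finally show False by blast
qed

theorem theorem3p7:
  shows "\<not> decidable_problem integral_nmda_pairs nmda_pair_code
           (\<lambda>(A, B). \<forall>w\<in>finite_words (alphabet A). finite_word_value A w = finite_word_value B w) \<and>
         \<not> decidable_problem integral_nmda_pairs nmda_pair_code
           (\<lambda>(A, B). \<forall>w\<in>infinite_words (alphabet A). infinite_word_value A w = infinite_word_value B w)"
proof
  show "\<not> decidable_problem integral_nmda_pairs nmda_pair_code
      (\<lambda>(A, B). \<forall>w\<in>finite_words (alphabet A). finite_word_value A w = finite_word_value B w)"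
    by (rule not_decidable, unfold prod.case, rule program_dfa.finite_equivalent_iff)
  show "\<not> decidable_problem integral_nmda_pairs nmda_pair_code
      (\<lambda>(A, B). \<forall>w\<in>infinite_words (alphabet A). infinite_word_value A w = infinite_word_value B w)"
    by (rule not_decidable, unfold prod.case, rule program_dfa.infinite_equivalent_iff)
qed

end
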